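(* Let $n,d\ge1$ be integers and $\beta,h\ge0$ reals. Suppose there is no FPRAS for the partition function of a family $\mathcal{M}\in\{\hat{\mathcal{M}}^+_{\textsc{Potts}}(n,d,\beta,h),\hat{\mathcal{M}}^-_{\textsc{Ising}}(n,d,\beta,h),\hat{\mathcal{M}}^+_{\textsc{Ising}}(n,d,\beta,h)\}$. Then for any $c>0$ there is no polynomial-time algorithm for the decision version of $n^c$-approximate counting for $\mathcal{M}$.
   Context: A $q$-state Potts model $(G,\beta_G,h_G)$ on $G=(V,E)$ has weights $w(\sigma)=\exp\big(\sum_{\{u,v\}\in E}\beta_G(\{u,v\})\mathbb{1}(\sigma(u)=\sigma(v))+\sum_vh_G(v,\sigma(v))\big)$, $\sigma\in[q]^V$, and partition function $Z_{G,\beta_G,h_G}=\sum_\sigma w(\sigma)$; the Ising model is $q=2$. $\hat{\mathcal{M}}^+_{\textsc{Potts}}(n,d,\beta,h)$ is the family of ferromagnetic $q$-state Potts models on $n$-vertex graphs of maximum degree at most $d$ in which every edge weight equals $\beta$ and $|h_G(v,i)|\le h$; $\hat{\mathcal{M}}^+_{\textsc{Ising}}$ is the same with $q=2$; $\hat{\mathcal{M}}^-_{\textsc{Ising}}(n,d,\beta,h)$ is the corresponding antiferromagnetic Ising family in which every edge has the same weight of absolute value $\beta$ (i.e. weight $-\beta$). An FPRAS for $Z$ outputs, for any $\rho>0$, $\hat Z$ with $e^{-\rho}Z\le\hat Z\le e^\rho Z$ with probability at least $3/4$ in time $\mathrm{poly}(n,1/\rho)$. Decision $r$-approximate counting: given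 a model $(G,\beta_G,h_G)$, a ratio $r>1$ and $\hat Z\in\mathbb{R}$, distinguish with probability at least $5/8$ between (i) $Z_{G,\beta_G,h_G}\le\hat Z/r$ and (ii) $Z_{G,\beta_G,h_G}\ge r\hat Z$. *)

theory Defs
  imports "HOL-Probability.Probability"
begin

section \<open>Potts models\<close>

text \<open>The vertex set is \<open>{..<order}\<close> and the set of spins is \<open>{1..spins}\<close>. Values of \<open>beta\<close>
  outside \<open>edges\<close>, and of \<open>field\<close> outside vertices and spins, are irrelevant.\<close>

record potts =
  spins :: nat
  order :: nat
  edges :: "nat set set"
  beta :: "nat set \<Rightarrow> real"
  field :: "nat \<Rightarrow> nat \<Rightarrow> real"

definition simple_graph :: "nat \<Rightarrow> nat set set \<Rightarrow> bool" where
  "simple_graph n E \<longleftrightarrow> (\<forall>e\<in>E. e \<subseteq> {..<n} \<and> card e = 2)"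

definition max_degree_le :: "nat \<Rightarrow> nat set set \<Rightarrow> nat \<Rightarrow> bool" where
  "max_degree_le n E d \<longleftrightarrow> (\<forall>v<n. card {e\<in>E. v \<in> e} \<le> d)"

definition configurations :: "potts \<Rightarrow> (nat \<Rightarrow> nat) set" where
  "configurations M = {..<order M} \<rightarrow>\<^sub>E {1..spins M}"

definition weight :: "potts \<Rightarrow> (nat \<Rightarrow> nat) \<Rightarrow> real" where
  "weight M \<sigma> = exp ((\<Sum>e\<in>edges M. beta M e * of_bool (\<forall>u\<in>e. \<forall>v\<in>e. \<sigma> u = \<sigma> v))
                    + (\<Sum>v<order M. field M v (\<sigma> v)))"

definition partition_function :: "potts \<Rightarrow> real" where
  "partition_function M = (\<Sum>\<sigma>\<in>configurations M. weight M \<sigma>)"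

definition ferromagnetic :: "potts \<Rightarrow> bool" where
  "ferromagnetic M \<longleftrightarrow> (\<forall>e\<in>edges M. beta M e \<ge> 0)"

definition antiferromagnetic :: "potts \<Rightarrow> bool" where
  "antiferromagnetic M \<longleftrightarrow> (\<forall>e\<in>edges M. beta M e \<le> 0)"

definition bounded_models :: "nat \<Rightarrow> nat \<Rightarrow> nat \<Rightarrow> real \<Rightarrow> potts set" where
  "bounded_models q n d h =
     {M. spins M = q \<and> order M = n \<and> simple_graph n (edges M) \<and> max_degree_le n (edges M) d
         \<and> (\<forall>v<n. \<forall>i\<in>{1..q}. \<bar>field M v i\<bar> \<le> h)}"

definition potts_plus :: "nat \<Rightarrow> nat \<Rightarrow> nat \<Rightarrow> real \<Rightarrow> real \<Rightarrow> potts set" where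
  "potts_plus q n d \<beta> h =
     {M \<in> bounded_models q n d h. ferromagnetic M \<and> (\<forall>e\<in>edges M. beta M e = \<beta>)}"

definition ising_plus :: "nat \<Rightarrow> nat \<Rightarrow> real \<Rightarrow> real \<Rightarrow> potts set" where
  "ising_plus n d \<beta> h = potts_plus 2 n d \<beta> h"

definition ising_minus :: "nat \<Rightarrow> nat \<Rightarrow> real \<Rightarrow> real \<Rightarrow> potts set" where
  "ising_minus n d \<beta> h =
     {M \<in> bounded_models 2 n d h. antiferromagnetic M \<and> (\<forall>e\<in>edges M. beta M e = - \<beta>)}"

section \<open>Randomised algorithms over the reals\<close>

text \<open>Inputs (\<open>\<beta>\<^sub>G\<close>, \<open>h\<^sub>G\<close>, \<open>\<rho>\<close>, the ratio and the guess) are real numbers and running times depend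
  only on \<open>n\<close> and \<open>1/\<rho>\<close>, so the machine model is a unit-cost one over the reals in the style of
  Blum, Shub and Smale: finite programs with real constants, exact field operations and
  comparisons. \<open>exp\<close> and \<open>ln\<close> are also primitive, so that Gibbs weights and ratios \<open>n\<^sup>c\<close> can be
  computed; there is no rounding operation. Memory is organised as in Jones's WHILE language: each
  variable holds a binary tree, here with real atoms. Assignments copy references, hence unit
  cost; trees can only be inspected one node at a time. \<open>Nul\<close> stands for false, every other value
  for true. Randomness comes from fair coin flips.\<close>

datatype val = Nul | Atom real | Pair val val

type_synonym store = "nat \<Rightarrow> val"

datatype expr =
    Var nat
  | Const real
  | NulE
  | PairE expr expr
  | Fst expr
  | Snd expr
  | IsAtom expr
  | Less expr expr
  | Add expr expr
  | Sub expr expr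
  | Mul expr expr
  | Div expr expr
  | Exp expr
  | Ln expr

datatype com =
    Skip
  | Assign nat expr
  | Flip nat
  | Seq com com
  | Cond expr com com
  | While expr com

fun num :: "val \<Rightarrow> real" where
  "num (Atom x) = x"
| "num _ = 0"

fun left :: "val \<Rightarrow> val" where
  "left (Pair a b) = a"
| "left _ = Nul"

fun right :: "val \<Rightarrow> val" where
  "right (Pair a b) = b"
| "right _ = Nul"

fun is_atom :: "val \<Rightarrow> bool" where
  "is_atom (Atom x) = True"
| "is_atom _ = False"

definition truth :: "bool \<Rightarrow> val" where
  "truth b = (if b then Atom 1 else Nul)"

primrec evaluate :: "expr \<Rightarrow> store \<Rightarrow> val" where
  "evaluate (Var x) s = s x"
| "evaluate (Const r) s = Atom r"
| "evaluate NulE s = Nul"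
| "evaluate (PairE a b) s = Pair (evaluate a s) (evaluate b s)"
| "evaluate (Fst a) s = left (evaluate a s)"
| "evaluate (Snd a) s = right (evaluate a s)"
| "evaluate (IsAtom a) s = truth (is_atom (evaluate a s))"
| "evaluate (Less a b) s = truth (num (evaluate a s) < num (evaluate b s))"
| "evaluate (Add a b) s = Atom (num (evaluate a s) + num (evaluate b s))"
| "evaluate (Sub a b) s = Atom (num (evaluate a s) - num (evaluate b s))"
| "evaluate (Mul a b) s = Atom (num (evaluate a s) * num (evaluate b s))"
| "evaluate (Div a b) s = Atom (num (evaluate a s) / num (evaluate b s))"
| "evaluate (Exp a) s = Atom (exp (num (evaluate a s)))"
| "evaluate (Ln a) s = Atom (let x = num (evaluate a s) in if x > 0 then ln x else 0)"

text \<open>The expressions of a program are fixed, so charging one step per command agrees, up to a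
  constant factor depending only on the program, with charging one step per operation.\<close>

primrec step :: "com \<Rightarrow> store \<Rightarrow> (com \<times> store) pmf" where
  "step Skip s = return_pmf (Skip, s)"
| "step (Assign x a) s = return_pmf (Skip, s(x := evaluate a s))"
| "step (Flip x) s = map_pmf (\<lambda>b. (Skip, s(x := truth b))) (bernoulli_pmf (1/2))"
| "step (Seq c1 c2) s =
     (if c1 = Skip then return_pmf (c2, s)
      else map_pmf (\<lambda>(c, s'). (Seq c c2, s')) (step c1 s))"
| "step (Cond a c1 c2) s = return_pmf (if evaluate a s \<noteq> Nul then c1 else c2, s)"
| "step (While a c) s = return_pmf (if evaluate a s \<noteq> Nul then Seq c (While a c) else Skip, s)"

primrec steps :: "nat \<Rightarrow> com \<times> store \<Rightarrow> (com \<times> store) pmf" where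
  "steps 0 cs = return_pmf cs"
| "steps (Suc t) cs = bind_pmf (steps t cs) (\<lambda>(c, s). step c s)"

text \<open>Variable 0 holds the input initially and the output on termination.\<close>

definition run :: "com \<Rightarrow> val \<Rightarrow> nat \<Rightarrow> (com \<times> store) pmf" where
  "run p inp t = steps t (p, (\<lambda>x. Nul)(0 := inp))"

definition halts_within :: "com \<Rightarrow> val \<Rightarrow> nat \<Rightarrow> bool" where
  "halts_within p inp t \<longleftrightarrow> (\<forall>(c, s) \<in> set_pmf (run p inp t). c = Skip)"

definition output_dist :: "com \<Rightarrow> val \<Rightarrow> nat \<Rightarrow> val pmf" where
  "output_dist p inp t = map_pmf (\<lambda>(c, s). s 0) (run p inp t)"

section \<open>Approximate counting\<close>

primrec encode_list :: "val list \<Rightarrow> val" where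
  "encode_list [] = Nul"
| "encode_list (v # vs) = Pair v (encode_list vs)"

text \<open>One entry per vertex, consisting of its external fields and its row of the weighted adjacency
  matrix, in which \<open>Nul\<close> marks a non-edge.\<close>

definition encode_vertex :: "potts \<Rightarrow> nat \<Rightarrow> val" where
  "encode_vertex M v = Pair
     (encode_list (map (\<lambda>i. Atom (field M v i)) [1..<spins M + 1]))
     (encode_list (map (\<lambda>u. if {u, v} \<in> edges M then Atom (beta M {u, v}) else Nul) [0..<order M]))"

definition encode :: "potts \<Rightarrow> val" where
  "encode M = encode_list (map (encode_vertex M) [0..<order M])"

text \<open>Families are indexed by the number of vertices. As \<open>n \<ge> 1\<close>, the bound \<open>C (n + 1/\<rho>)\<^sup>k\<close>
  (below: \<open>C n\<^sup>k\<close>) is equivalent to an arbitrary polynomial bound in \<open>n\<close> and \<open>1/\<rho>\<close> (in \<open>n\<close>).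
  Halted configurations are fixed by \<^const>\<open>step\<close>, so the output distribution does not depend on
  the choice of \<open>t\<close>.\<close>

definition fpras :: "(nat \<Rightarrow> potts set) \<Rightarrow> com \<Rightarrow> bool" where
  "fpras \<M> p \<longleftrightarrow>
     (\<exists>C k. \<forall>n\<ge>1. \<forall>M\<in>\<M> n. \<forall>\<rho>>0. \<exists>t.
        let inp = Pair (Atom \<rho>) (encode M); Z = partition_function M in
        real t \<le> C * (real n + 1 / \<rho>) ^ k \<and> halts_within p inp t
        \<and> measure_pmf.prob (output_dist p inp t)
             {Atom z | z. exp (- \<rho>) * Z \<le> z \<and> z \<le> exp \<rho> * Z} \<ge> 3/4)"

text \<open>The answer \<open>Nul\<close> claims \<open>Z \<le> guess / r\<close>, any other answer claims \<open>Z \<ge> r * guess\<close>. The problem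
  is defined for ratios above 1 only, so nothing is asked for those \<open>n\<close> with \<open>r n \<le> 1\<close>
  (for \<open>r n = n\<^sup>c\<close> this is \<open>n = 1\<close>).\<close>

definition poly_time_decision :: "(nat \<Rightarrow> potts set) \<Rightarrow> (nat \<Rightarrow> real) \<Rightarrow> com \<Rightarrow> bool" where
  "poly_time_decision \<M> r p \<longleftrightarrow>
     (\<exists>C k. \<forall>n\<ge>1. r n > 1 \<longrightarrow> (\<forall>M\<in>\<M> n. \<forall>guess::real. \<exists>t.
        let inp = Pair (Atom (r n)) (Pair (Atom guess) (encode M)); Z = partition_function M in
        real t \<le> C * real n ^ k \<and> halts_within p inp t
        \<and> (Z \<le> guess / r n \<longrightarrow> measure_pmf.prob (output_dist p inp t) {Nul} \<ge> 5/8)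
        \<and> (Z \<ge> r n * guess \<longrightarrow> measure_pmf.prob (output_dist p inp t) (- {Nul}) \<ge> 5/8)))"

end

theory Submission
  imports Defs
begin

text \<open>The partition function of \<open>K\<close> disjoint copies of a model is the \<open>K\<close>-th power of the original one,
  and the copies stay in the family. Hence a decision procedure with ratio \<open>(K n)\<^sup>c\<close>, applied to the
  copies with guess \<open>exp (K y)\<close>, compares \<open>y\<close> with \<open>ln Z\<close> up to an error \<open>c ln (K n) / K\<close>, which is at
  most \<open>\<rho>/20\<close> for some \<open>K\<close> polynomial in \<open>n\<close> and \<open>1/\<rho>\<close>.

  The errors of the procedure are absorbed by a random walk instead of a binary search with majority
  votes: starting from \<open>y = 0\<close>, each answer moves \<open>y\<close> by \<open>\<rho>/20\<close> in the direction that it suggests. In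
  units of \<open>\<rho>/20\<close>, the potential \<open>(4/3)\<^sup>x + (4/3)\<^sup>-\<^sup>x\<close> of the distance \<open>x\<close> to \<open>ln Z\<close> satisfies
  \<open>E \<Phi>' \<le> 31/32 \<Phi> + 1\<close>. As \<open>ln Z = O(n\<^sup>2)\<close>, after \<open>O(n\<^sup>2/\<rho>)\<close> steps its expectation is at most 34, so that
  by Markov's inequality \<open>y\<close> is within \<open>\<rho>\<close> of \<open>ln Z\<close> with probability at least 3/4.\<close>

section \<open>Expectations of program runs\<close>

text \<open>Expectation of \<open>f\<close> in the store reached after \<open>t\<close> steps, where runs that have not halted by
  then count as \<open>\<top>\<close>; a finite value therefore certifies termination within \<open>t\<close> steps. Assertions
  are encoded in the same way, by functions that are \<open>\<top>\<close> where the assertion fails.\<close>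

primrec wp :: "nat \<Rightarrow> com \<Rightarrow> (store \<Rightarrow> ennreal) \<Rightarrow> store \<Rightarrow> ennreal" where
  "wp 0 c f s = (if c = Skip then f s else \<top>)"
| "wp (Suc t) c f s = (\<integral>\<^sup>+ (c', s'). wp t c' f s' \<partial>step c s)"

text \<open>\<open>steps\<close> adds transitions at the end of a run, whereas \<open>wp\<close>
  peels them off at the start; associativity of the monadic bind turns one recursion into the
  other.\<close>

lemma steps_Suc_first: "steps (Suc t) cs = bind_pmf (case cs of (c, s) \<Rightarrow> step c s) (steps t)"
proof (induction t)
  case 0
  show ?case by (simp add: bind_return_pmf bind_return_pmf')
next
  case (Suc t)
  have "steps (Suc (Suc t)) cs = bind_pmf (steps (Suc t) cs) (\<lambda>(c, s). step c s)"
    by simp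
  also have "\<dots> = bind_pmf (case cs of (c, s) \<Rightarrow> step c s)
      (\<lambda>cs'. bind_pmf (steps t cs') (\<lambda>(c, s). step c s))"
    unfolding Suc by (rule bind_assoc_pmf)
  also have "\<dots> = bind_pmf (case cs of (c, s) \<Rightarrow> step c s) (steps (Suc t))"
    by (intro bind_pmf_cong refl) simp
  finally show ?case .
qed

lemma wp_eq_nn_integral_steps:
  "wp t c f s = (\<integral>\<^sup>+ (c', s'). (if c' = Skip then f s' else \<top>) \<partial>steps t (c, s))"
proof (induction t arbitrary: c s)
  case 0
  show ?case by simp
next
  case (Suc t)
  show ?case
    unfolding steps_Suc_first by (simp add: Suc case_prod_unfold)
qed

lemma wp_mono: "(\<And>s. f s \<le> g s) \<Longrightarrow> wp t c f s \<le> wp t c g s"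
  by (induction t arbitrary: c s) (auto intro!: nn_integral_mono)

lemma wp_Skip [simp]: "wp t Skip f s = f s"
  by (induction t) auto

text \<open>A run that has not halted already counts as \<open>\<top>\<close>, and a halted one is
  fixed, so a larger step budget can only lower the expectation.\<close>

lemma wp_Suc_le: "wp (Suc t) c f s \<le> wp t c f s"
proof (induction t arbitrary: c s)
  case 0
  show ?case by simp
next
  case (Suc t)
  show ?case
    by (subst (1 2) wp.simps(2)) (auto intro!: nn_integral_mono Suc simp del: wp.simps)
qed

lemma wp_antimono: "t \<le> t' \<Longrightarrow> wp t' c f s \<le> wp t c f s"
  by (rule lift_Suc_antimono_le[of "\<lambda>t. wp t c f s"]) (auto intro: wp_Suc_le simp del: wp.simps)

lemma wp_Assign [simp]: "wp (Suc t) (Assign x a) f s = f (s(x := evaluate a s))"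
  by simp

lemma wp_Cond [simp]:
  "wp (Suc t) (Cond a c1 c2) f s = wp t (if evaluate a s \<noteq> Nul then c1 else c2) f s"
  by simp

lemma wp_While:
  "wp (Suc t) (While a c) f s = (if evaluate a s \<noteq> Nul then wp t (Seq c (While a c)) f s else f s)"
  by simp

lemma wp_Seq: "wp (t1 + t2 + 1) (Seq c1 c2) f s \<le> wp t1 c1 (wp t2 c2 f) s"
proof (induction t1 arbitrary: c1 s)
  case 0
  show ?case by simp
next
  case (Suc t1)
  show ?case
  proof (cases "c1 = Skip")
    case True
    then show ?thesis using wp_antimono[of t2 "Suc (t1 + t2)" c2 f s] by simp
  next
    case False
    have "wp (Suc t1 + t2 + 1) (Seq c1 c2) f s
        = (\<integral>\<^sup>+ (c', s'). wp (t1 + t2 + 1) (Seq c' c2) f s' \<partial>step c1 s)"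
      using False by (simp add: case_prod_unfold del: wp.simps(2) add: wp.simps(2)[of "Suc (t1 + t2)"])
    also have "\<dots> \<le> (\<integral>\<^sup>+ (c', s'). wp t1 c' (wp t2 c2 f) s' \<partial>step c1 s)"
      using Suc by (auto intro!: nn_integral_mono simp del: wp.simps)
    finally show ?thesis by simp
  qed
qed

declare wp.simps(2) [simp del]

text \<open>\<open>J k\<close> bounds the expectation with \<open>k\<close> iterations to go and is
  \<open>\<top>\<close> where the loop invariant fails, so the premises need checking only under the
  invariant. An iteration costs two steps beyond its body, for the test and for leaving the
  \<open>Seq\<close>; the final 1 is the failing test.\<close>

lemma wp_while_le:
  assumes step: "\<And>k s. J (Suc k) s < \<top> \<Longrightarrow> evaluate b s \<noteq> Nul \<and> wp t c (J k) s \<le> J (Suc k) s"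
    and exit: "\<And>s. J 0 s < \<top> \<Longrightarrow> evaluate b s = Nul \<and> f s \<le> J 0 s"
  shows "wp (k * (t + 2) + 1) (While b c) f s \<le> J k s"
proof (induction k arbitrary: s)
  case 0
  show ?case
    using exit[of s] by (cases "J 0 s < \<top>") (auto simp: not_less top_unique wp_While)
next
  case (Suc k)
  show ?case
  proof (cases "J (Suc k) s < \<top>")
    case True
    have "wp (Suc k * (t + 2) + 1) (While b c) f s
        = wp (t + (k * (t + 2) + 1) + 1) (Seq c (While b c)) f s"
      using step[OF True] by (simp add: wp_While del: wp.simps add: algebra_simps)
    also have "\<dots> \<le> wp t c (wp (k * (t + 2) + 1) (While b c) f) s"
      by (rule wp_Seq)
    also have "\<dots> \<le> wp t c (J k) s"
      by (rule wp_mono) (rule Suc)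
    also have "\<dots> \<le> J (Suc k) s"
      using step[OF True] by simp
    finally show ?thesis .
  qed (simp add: not_less top_unique)
qed

text \<open>Taking \<open>f\<close> to be 0 at \<open>s'\<close> and \<open>\<top>\<close> elsewhere
  shows that \<open>c\<close> surely halts in \<open>s'\<close> within \<open>t\<close> steps.
  Quantifying over all \<open>f\<close> lets the rules below follow from those of \<open>wp\<close>
  by transitivity.\<close>

definition det :: "com \<Rightarrow> store \<Rightarrow> nat \<Rightarrow> store \<Rightarrow> bool" where
  "det c s t s' \<longleftrightarrow> (\<forall>f. wp t c f s \<le> f s')"

lemma det_Assign: "det (Assign x a) s 1 (s(x := evaluate a s))"
  unfolding det_def One_nat_def by (simp only: wp_Assign order_refl simp_thms)

lemma det_mono: "det c s t s' \<Longrightarrow> t \<le> t' \<Longrightarrow> det c s t' s'"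
  unfolding det_def by (meson order_trans wp_antimono)

lemma det_Seq:
  assumes "det c1 s t1 s1" and "det c2 s1 t2 s2"
  shows "det (Seq c1 c2) s (t1 + t2 + 1) s2"
  using assms unfolding det_def by (meson order_trans wp_Seq)

lemma det_Cond:
  assumes "det (if evaluate a s \<noteq> Nul then c1 else c2) s t s'"
  shows "det (Cond a c1 c2) s (Suc t) s'"
  using assms unfolding det_def by (simp del: wp.simps)

lemma det_While_exit: "evaluate a s = Nul \<Longrightarrow> det (While a c) s 1 s"
  by (simp add: det_def wp_While)

lemma det_While_unfold:
  assumes "evaluate a s \<noteq> Nul" "det c s t1 s1" "det (While a c) s1 t2 s2"
  shows "det (While a c) s (t1 + t2 + 2) s2"
  using det_Seq[OF assms(2,3)] assms(1) unfolding det_def by (simp add: wp_While del: wp.simps)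

text \<open>Unlike in \<open>wp_while_le\<close>, the index counts the iterations already done,
  which suits accumulators; the induction runs over the \<open>j\<close> that remain.\<close>

lemma det_while:
  assumes step: "\<And>k s. k < N \<Longrightarrow> I k s \<Longrightarrow> evaluate b s \<noteq> Nul \<and> (\<exists>s'. det c s t s' \<and> I (Suc k) s')"
    and exit: "\<And>s. I N s \<Longrightarrow> evaluate b s = Nul"
    and init: "I 0 s"
  shows "\<exists>s'. det (While b c) s (N * (t + 2) + 1) s' \<and> I N s'"
proof -
  have "\<exists>s'. det (While b c) s (j * (t + 2) + 1) s' \<and> I N s'" if "I (N - j) s" "j \<le> N" for j s
    using that
  proof (induction j arbitrary: s)
    case 0
    then show ?case using exit[of s] det_While_exit[of b s c] by auto
  next
    case (Suc j)
    then obtain s1 where *: "evaluate b s \<noteq> Nul" "det c s t s1" "I (Suc (N - Suc j)) s1"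
      using step[of "N - Suc j" s] by auto
    then have "I (N - j) s1" using Suc.prems by (simp add: Suc_diff_Suc)
    then obtain s2 where "det (While b c) s1 (j * (t + 2) + 1) s2" "I N s2"
      using Suc by fastforce
    with det_While_unfold[OF *(1,2) this(1)] show ?case
      by (auto simp: algebra_simps)
  qed
  from this[of N s] init show ?thesis by simp
qed

text \<open>The list variable is consumed: its head is the current element, which the body reads as
  \<open>Fst (Var x)\<close>, and the empty list \<open>Nul\<close> ends the loop.\<close>

definition foreach :: "nat \<Rightarrow> com \<Rightarrow> com" where
  "foreach x c = While (Var x) (Seq c (Assign x (Snd (Var x))))"

text \<open>The invariant speaks of the processed prefix \<open>ys\<close>. It has to survive
  changes of \<open>x\<close> because the list variable is overwritten after each run of the
  body.\<close>

lemma det_foreach: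
  assumes body: "\<And>ys y zs s. xs = ys @ y # zs \<Longrightarrow> I ys s \<Longrightarrow> s x = Pair (F y) (encode_list (map F zs))
      \<Longrightarrow> \<exists>s'. det c s t s' \<and> s' x = s x \<and> I (ys @ [y]) s'"
    and indep: "\<And>ys s v. I ys s \<Longrightarrow> I ys (s(x := v))"
    and init: "I [] s" "s x = encode_list (map F xs)"
  shows "\<exists>s'. det (foreach x c) s (length xs * (t + 4) + 1) s' \<and> I xs s'"
proof -
  let ?I = "\<lambda>k s. I (take k xs) s \<and> s x = encode_list (map F (drop k xs))"
  have "\<exists>s'. det (foreach x c) s (length xs * ((t + 2) + 2) + 1) s' \<and> ?I (length xs) s'"
    unfolding foreach_def
  proof (rule det_while)
    fix k s assume k: "k < length xs" and I: "?I k s"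
    have split: "xs = take k xs @ xs ! k # drop (Suc k) xs"
      using k by (rule id_take_nth_drop)
    have sx: "s x = Pair (F (xs ! k)) (encode_list (map F (drop (Suc k) xs)))"
      using I k by (metis Cons_nth_drop_Suc encode_list.simps(2) list.simps(9))
    obtain s1 where s1: "det c s t s1" "s1 x = s x" "I (take k xs @ [xs ! k]) s1"
      using body[OF split conjunct1[OF I] sx] by blast
    let ?s = "s1(x := evaluate (Snd (Var x)) s1)"
    have "det (Seq c (Assign x (Snd (Var x)))) s (t + 2) ?s"
      using det_Seq[OF s1(1) det_Assign[of x "Snd (Var x)"]] by simp
    moreover have "?I (Suc k) ?s"
      using indep[OF s1(3)] s1(2) sx k by (simp add: take_Suc_conv_app_nth)
    ultimately show "evaluate (Var x) s \<noteq> Nul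
        \<and> (\<exists>s'. det (Seq c (Assign x (Snd (Var x)))) s (t + 2) s' \<and> ?I (Suc k) s')"
      using sx by auto
  qed (use init in auto)
  moreover have "length xs * ((t + 2) + 2) + 1 = length xs * (t + 4) + 1"
    by (simp add: algebra_simps)
  ultimately show ?thesis by auto
qed

section \<open>Variables of a program and subroutine calls\<close>

primrec evars :: "expr \<Rightarrow> nat set" where
  "evars (Var x) = {x}"
| "evars (Const r) = {}"
| "evars NulE = {}"
| "evars (PairE a b) = evars a \<union> evars b"
| "evars (Fst a) = evars a"
| "evars (Snd a) = evars a"
| "evars (IsAtom a) = evars a"
| "evars (Less a b) = evars a \<union> evars b"
| "evars (Add a b) = evars a \<union> evars b"
| "evars (Sub a b) = evars a \<union> evars b"
| "evars (Mul a b) = evars a \<union> evars b"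
| "evars (Div a b) = evars a \<union> evars b"
| "evars (Exp a) = evars a"
| "evars (Ln a) = evars a"

primrec cvars :: "com \<Rightarrow> nat set" where
  "cvars Skip = {}"
| "cvars (Assign x a) = insert x (evars a)"
| "cvars (Flip x) = {x}"
| "cvars (Seq c1 c2) = cvars c1 \<union> cvars c2"
| "cvars (Cond a c1 c2) = evars a \<union> cvars c1 \<union> cvars c2"
| "cvars (While a c) = evars a \<union> cvars c"

lemma finite_evars: "finite (evars a)"
  by (induction a) auto

lemma finite_cvars: "finite (cvars c)"
  by (induction c) (auto simp: finite_evars)

text \<open>A subroutine runs in the variables below \<open>m\<close>, its caller keeps the remaining ones.\<close>

definition overlay :: "nat \<Rightarrow> store \<Rightarrow> store \<Rightarrow> store" where
  "overlay m s' s = (\<lambda>x. if x < m then s' x else s x)"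

lemma evaluate_overlay: "evars a \<subseteq> {..<m} \<Longrightarrow> evaluate a (overlay m s' s) = evaluate a s'"
  by (induction a) (auto simp: overlay_def)

lemma overlay_upd: "x < m \<Longrightarrow> (overlay m s' s)(x := v) = overlay m (s'(x := v)) s"
  by (auto simp: overlay_def)

lemma step_overlay:
  "cvars c \<subseteq> {..<m} \<Longrightarrow>
    step c (overlay m s' s) = map_pmf (\<lambda>(c', s''). (c', overlay m s'' s)) (step c s')"
  by (induction c)
    (auto simp: evaluate_overlay overlay_upd pmf.map_comp o_def case_prod_unfold)

lemma cvars_step: "(c', s') \<in> set_pmf (step c s) \<Longrightarrow> cvars c' \<subseteq> cvars c"
  by (induction c arbitrary: c' s') (force split: if_splits)+

text \<open>The caller's variables are inert while the subroutine runs, so they can be moved from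
  the initial store into the postcondition. This makes guarantees stated for the initial store of
  \<open>run\<close> usable inside a larger program.\<close>

lemma wp_overlay:
  "cvars c \<subseteq> {..<m} \<Longrightarrow> wp t c f (overlay m s' s) = wp t c (\<lambda>s''. f (overlay m s'' s)) s'"
proof (induction t arbitrary: c s')
  case 0
  show ?case by simp
next
  case (Suc t)
  have "wp t c' f (overlay m s'' s) = wp t c' (\<lambda>s''. f (overlay m s'' s)) s''"
    if "(c', s'') \<in> set_pmf (step c s')" for c' s''
    using Suc cvars_step[OF that] by auto
  then show ?case
    unfolding wp.simps step_overlay[OF Suc.prems]
    by (auto simp: case_prod_unfold intro!: nn_integral_cong_AE AE_pmfI)
qed

section \<open>Halting and error probabilities read off from expectations\<close>

lemma wp_output:
  assumes "halts_within p inp t"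
  shows "wp t p (\<lambda>s. g (s 0)) ((\<lambda>x. Nul)(0 := inp)) = (\<integral>\<^sup>+ v. g v \<partial>output_dist p inp t)"
  unfolding wp_eq_nn_integral_steps output_dist_def nn_integral_map_pmf
  using assms unfolding halts_within_def run_def
  by (intro nn_integral_cong_AE AE_pmfI) auto

text \<open>A finite expectation leaves no mass on runs that count as \<open>\<top>\<close>, so the
  program halts; the expectation of the indicator of failure is then the failure
  probability.\<close>

lemma wp_output_error:
  assumes "wp t p (\<lambda>s. indicator (- G) (s 0)) ((\<lambda>x. Nul)(0 := inp)) \<le> ennreal \<epsilon>" "\<epsilon> \<ge> 0"
  shows "halts_within p inp t" and "measure_pmf.prob (output_dist p inp t) G \<ge> 1 - \<epsilon>"
proof -
  let ?g = "\<lambda>(c, s). if c = Skip then indicator (- G) (s 0) else \<top> :: ennreal"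
  have fin: "(\<integral>\<^sup>+ cs. ?g cs \<partial>run p inp t) \<noteq> \<infinity>"
    using assms unfolding wp_eq_nn_integral_steps run_def by (auto simp: top_unique)
  have "AE cs in run p inp t. ?g cs \<noteq> \<infinity>"
    by (rule nn_integral_noteq_infinite[OF _ fin]) simp
  then show halts: "halts_within p inp t"
    unfolding halts_within_def AE_measure_pmf_iff by (auto split: if_splits)
  have "wp t p (\<lambda>s. indicator (- G) (s 0)) ((\<lambda>x. Nul)(0 := inp))
      = ennreal (measure_pmf.prob (output_dist p inp t) (- G))"
    unfolding wp_output[OF halts, of "indicator (- G)"] by (simp add: measure_pmf.emeasure_eq_measure)
  then have "measure_pmf.prob (output_dist p inp t) (- G) \<le> \<epsilon>"
    using assms by simp
  then show "measure_pmf.prob (output_dist p inp t) G \<ge> 1 - \<epsilon>"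
    using measure_pmf.prob_compl[of G "output_dist p inp t"] by (auto simp: Compl_eq_Diff_UNIV)
qed

lemma nn_integral_two_valued:
  fixes a b :: real
  assumes "a \<ge> 0" "b \<ge> 0"
  shows "(\<integral>\<^sup>+ v. (if v \<in> A then ennreal a else ennreal b) \<partial>measure_pmf D)
    = ennreal (measure_pmf.prob D A * a + (1 - measure_pmf.prob D A) * b)"
proof -
  have "(\<integral>\<^sup>+ v. (if v \<in> A then ennreal a else ennreal b) \<partial>measure_pmf D)
      = (\<integral>\<^sup>+ v. ennreal a * indicator A v + ennreal b * indicator (- A) v \<partial>measure_pmf D)"
    by (intro nn_integral_cong) (auto simp: indicator_def)
  also have "\<dots> = ennreal a * emeasure D A + ennreal b * emeasure D (- A)"
    by (simp add: nn_integral_add nn_integral_cmult)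
  also have "\<dots> = ennreal (a * measure_pmf.prob D A + b * measure_pmf.prob D (- A))"
    using assms by (simp add: measure_pmf.emeasure_eq_measure ennreal_mult ennreal_plus)
  also have "measure_pmf.prob D (- A) = 1 - measure_pmf.prob D A"
    using measure_pmf.prob_compl[of A D] by (simp add: Compl_eq_Diff_UNIV)
  finally show ?thesis by (simp add: mult.commute)
qed

section \<open>Disjoint copies\<close>

text \<open>A common form of the three families: the sign of \<open>b\<close> is free, so the
  reduction is carried out only once.\<close>

definition uniform_models :: "nat \<Rightarrow> nat \<Rightarrow> real \<Rightarrow> real \<Rightarrow> nat \<Rightarrow> potts set" where
  "uniform_models q d b h n = {M \<in> bounded_models q n d h. \<forall>e\<in>edges M. beta M e = b}"

text \<open>Vertex \<open>i\<close> of copy \<open>a\<close>, in reversed order because consing onto an accumulator while walking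
  through a list reverses it.\<close>

definition cell :: "nat \<Rightarrow> nat \<Rightarrow> nat \<Rightarrow> nat \<Rightarrow> nat" where
  "cell K n a i = K * n - 1 - (a * n + i)"

definition cell_copy :: "nat \<Rightarrow> nat \<Rightarrow> nat \<Rightarrow> nat" where
  "cell_copy K n v = (K * n - 1 - v) div n"

definition cell_index :: "nat \<Rightarrow> nat \<Rightarrow> nat \<Rightarrow> nat" where
  "cell_index K n v = (K * n - 1 - v) mod n"

definition copies :: "nat \<Rightarrow> potts \<Rightarrow> potts" where
  "copies K M = \<lparr>spins = spins M, order = K * order M,
     edges = (\<Union>a<K. (\<lambda>e. cell K (order M) a ` e) ` edges M),
     beta = (\<lambda>e. beta M (cell_index K (order M) ` e)),
     field = (\<lambda>v. field M (cell_index K (order M) v))\<rparr>"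

lemma copies_sel [simp]:
  "spins (copies K M) = spins M"
  "order (copies K M) = K * order M"
  "beta (copies K M) e = beta M (cell_index K (order M) ` e)"
  "field (copies K M) v = field M (cell_index K (order M) v)"
  by (simp_all add: copies_def)

section \<open>The bijection between cells and pairs of copy and index\<close>

lemma cell_bound:
  fixes a K i n :: nat
  assumes "a < K" "i < n"
  shows "a * n + i < K * n"
proof -
  have "a * n + i < Suc a * n" using assms by simp
  also have "\<dots> \<le> K * n" using assms by (intro mult_right_mono) auto
  finally show ?thesis .
qed

lemma cell_less: "a < K \<Longrightarrow> i < n \<Longrightarrow> cell K n a i < K * n"
  using cell_bound[of a K i n] by (simp add: cell_def)

lemma cell_copy_cell [simp]: "a < K \<Longrightarrow> i < n \<Longrightarrow> cell_copy K n (cell K n a i) = a"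
  using cell_bound[of a K i n] by (simp add: cell_copy_def cell_def)

lemma cell_index_cell [simp]: "a < K \<Longrightarrow> i < n \<Longrightarrow> cell_index K n (cell K n a i) = i"
  using cell_bound[of a K i n] by (simp add: cell_index_def cell_def)

lemma cell_cell_copy: "v < K * n \<Longrightarrow> cell K n (cell_copy K n v) (cell_index K n v) = v"
  by (simp add: cell_def cell_copy_def cell_index_def)

lemma cell_copy_less: "v < K * n \<Longrightarrow> cell_copy K n v < K"
  by (cases "n = 0") (auto simp: cell_copy_def less_mult_imp_div_less)

lemma cell_index_less: "v < K * n \<Longrightarrow> cell_index K n v < n"
  by (cases "n = 0") (auto simp: cell_index_def)

lemma cell_index_cell_image:
  assumes "a < K" "e \<subseteq> {..<n}"
  shows "cell_index K n ` cell K n a ` e = e"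
proof -
  have "(\<lambda>i. cell_index K n (cell K n a i)) ` e = (\<lambda>i. i) ` e"
    using assms by (intro image_cong) auto
  then show ?thesis by (simp add: image_image)
qed

lemma inj_on_cell: "a < K \<Longrightarrow> inj_on (cell K n a) {..<n}"
  by (metis cell_index_cell inj_onI lessThan_iff)

lemma edges_copies_iff:
  assumes M: "simple_graph n (edges M)" "order M = n" and uv: "u < K * n" "v < K * n"
  shows "{u, v} \<in> edges (copies K M) \<longleftrightarrow>
    cell_copy K n u = cell_copy K n v \<and> {cell_index K n u, cell_index K n v} \<in> edges M"
proof
  assume "{u, v} \<in> edges (copies K M)"
  then obtain a e where ae: "a < K" "e \<in> edges M" "{u, v} = cell K n a ` e"
    using M by (auto simp: copies_def)
  have e: "e \<subseteq> {..<n}" using M ae by (auto simp: simple_graph_def)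
  have "u \<in> cell K n a ` e" "v \<in> cell K n a ` e" using ae(3) by blast+
  then have "cell_copy K n u = a" "cell_copy K n v = a" using ae e by auto
  moreover have "{cell_index K n u, cell_index K n v} = cell_index K n ` {u, v}" by simp
  ultimately show "cell_copy K n u = cell_copy K n v \<and> {cell_index K n u, cell_index K n v} \<in> edges M"
    using ae cell_index_cell_image[OF ae(1) e] by simp
next
  assume *: "cell_copy K n u = cell_copy K n v \<and> {cell_index K n u, cell_index K n v} \<in> edges M"
  have "{u, v} = cell K n (cell_copy K n u) ` {cell_index K n u, cell_index K n v}"
    using * cell_cell_copy[OF uv(1)] cell_cell_copy[OF uv(2)] by simp
  then show "{u, v} \<in> edges (copies K M)"
    using * cell_copy_less[OF uv(1)] M unfolding copies_def by fastforce
qed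

lemma simple_graph_finite: "simple_graph n E \<Longrightarrow> finite E"
  unfolding simple_graph_def by (rule finite_subset[of _ "Pow {..<n}"]) auto

text \<open>No edge joins two copies, so degrees, edge weights and fields are inherited from a
  single copy.\<close>

lemma copies_uniform_models:
  assumes "M \<in> uniform_models q d b h n"
  shows "copies K M \<in> uniform_models q d b h (K * n)"
proof -
  have M: "spins M = q" "order M = n" "simple_graph n (edges M)" "max_degree_le n (edges M) d"
    "\<And>v i. v < n \<Longrightarrow> i \<in> {1..q} \<Longrightarrow> \<bar>field M v i\<bar> \<le> h" "\<And>e. e \<in> edges M \<Longrightarrow> beta M e = b"
    using assms by (auto simp: uniform_models_def bounded_models_def)
  have sub: "e \<subseteq> {..<n}" "card e = 2" if "e \<in> edges M" for e
    using M(3) that by (auto simp: simple_graph_def)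
  have "simple_graph (K * n) (edges (copies K M))"
    unfolding simple_graph_def
  proof
    fix e assume "e \<in> edges (copies K M)"
    then obtain a e' where ae: "a < K" "e' \<in> edges M" "e = cell K n a ` e'"
      using M by (auto simp: copies_def)
    show "e \<subseteq> {..<K * n} \<and> card e = 2"
      using ae sub[OF ae(2)] card_image[OF inj_on_subset[OF inj_on_cell[OF ae(1)] sub(1)[OF ae(2)]]]
      by (auto intro!: cell_less)
  qed
  moreover have "max_degree_le (K * n) (edges (copies K M)) d"
    unfolding max_degree_le_def
  proof (intro allI impI)
    fix v assume v: "v < K * n"
    let ?S = "{e \<in> edges M. cell_index K n v \<in> e}"
    \<comment> \<open>All edges at \<open>v\<close> lie in the copy of \<open>v\<close> and come
      from edges of \<open>M\<close> at its index, so the degree does not grow.\<close>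
    have "{e \<in> edges (copies K M). v \<in> e} \<subseteq> (\<lambda>e. cell K n (cell_copy K n v) ` e) ` ?S"
    proof
      fix e assume "e \<in> {e \<in> edges (copies K M). v \<in> e}"
      then obtain a e' where ae: "a < K" "e' \<in> edges M" "e = cell K n a ` e'" "v \<in> e"
        using M by (auto simp: copies_def)
      then obtain i where i: "i \<in> e'" "v = cell K n a i" by auto
      then have "i < n" using sub ae by auto
      then show "e \<in> (\<lambda>e. cell K n (cell_copy K n v) ` e) ` ?S"
        using ae i by auto
    qed
    moreover have fin: "finite ?S" using simple_graph_finite[OF M(3)] by simp
    ultimately have "card {e \<in> edges (copies K M). v \<in> e} \<le> card ?S"
      using surj_card_le by blast
    also have "\<dots> \<le> d" using M(4) cell_index_less[OF v] by (auto simp: max_degree_le_def)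
    finally show "card {e \<in> edges (copies K M). v \<in> e} \<le> d" .
  qed
  moreover have "beta (copies K M) e = b" if e: "e \<in> edges (copies K M)" for e
  proof -
    obtain a e' where ae: "a < K" "e' \<in> edges M" "e = cell K n a ` e'"
      using M(2) e by (auto simp: copies_def)
    then show ?thesis
      using cell_index_cell_image[OF ae(1) sub(1)[OF ae(2)]] M by (simp add: copies_def)
  qed
  moreover have "\<bar>field (copies K M) v i\<bar> \<le> h" if "v < K * n" "i \<in> {1..q}" for v i
    using M(5)[OF cell_index_less[OF that(1)] that(2)] M(2) by (simp add: copies_def)
  ultimately show ?thesis
    using M by (auto simp: uniform_models_def bounded_models_def copies_def)
qed

section \<open>The partition function of disjoint copies\<close>

lemma sum_cells:
  fixes f :: "nat \<Rightarrow> real"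
  shows "(\<Sum>v<K * n. f v) = (\<Sum>a<K. \<Sum>i<n. f (cell K n a i))"
proof -
  have "(\<Sum>v<K * n. f v) = (\<Sum>(a, i)\<in>{..<K} \<times> {..<n}. f (cell K n a i))"
    by (rule sum.reindex_bij_witness[of _ "\<lambda>(a, i). cell K n a i"
          "\<lambda>v. (cell_copy K n v, cell_index K n v)"])
      (auto simp: cell_cell_copy cell_copy_less cell_index_less cell_less)
  then show ?thesis by (simp add: sum.cartesian_product)
qed

lemma sum_edges_copies:
  fixes f :: "nat set \<Rightarrow> real"
  assumes M: "simple_graph n (edges M)" "order M = n"
  shows "(\<Sum>e\<in>edges (copies K M). f e) = (\<Sum>a<K. \<Sum>e\<in>edges M. f (cell K n a ` e))"
proof -
  have sub: "e \<subseteq> {..<n}" "e \<noteq> {}" if "e \<in> edges M" for e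
    using M(1) that by (auto simp: simple_graph_def)
  have "(\<Sum>e\<in>edges (copies K M). f e) = (\<Sum>a<K. \<Sum>e\<in>(\<lambda>e. cell K n a ` e) ` edges M. f e)"
    unfolding copies_def potts.simps M(2)
  proof (rule sum.UNION_disjoint)
    show "\<forall>a\<in>{..<K}. \<forall>a'\<in>{..<K}. a \<noteq> a' \<longrightarrow>
        (\<lambda>e. cell K n a ` e) ` edges M \<inter> (\<lambda>e. cell K n a' ` e) ` edges M = {}"
    proof (intro ballI impI)
      fix a a' assume a: "a \<in> {..<K}" "a' \<in> {..<K}" "a \<noteq> a'"
      have "cell K n a ` e \<noteq> cell K n a' ` e'" if e: "e \<in> edges M" and e': "e' \<in> edges M" for e e'
      proof
        assume eq: "cell K n a ` e = cell K n a' ` e'"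
        \<comment> \<open>Edges are non-empty, and the copy number of any endpoint reveals
          \<open>a\<close>.\<close>
        obtain i where i: "i \<in> e" using sub[OF e] by auto
        then obtain i' where "i' \<in> e'" "cell K n a i = cell K n a' i'" using eq by blast
        moreover have "i < n" "i' < n" using i \<open>i' \<in> e'\<close> sub[OF e] sub[OF e'] by auto
        ultimately show False using a cell_copy_cell by (metis lessThan_iff)
      qed
      then show "(\<lambda>e. cell K n a ` e) ` edges M \<inter> (\<lambda>e. cell K n a' ` e) ` edges M = {}"
        by auto
    qed
  qed (use simple_graph_finite[OF M(1)] in auto)
  also have "\<dots> = (\<Sum>a<K. \<Sum>e\<in>edges M. f (cell K n a ` e))"
  proof (rule sum.cong[OF refl])
    fix a assume "a \<in> {..<K}"
    then have "inj_on (\<lambda>e. cell K n a ` e) (edges M)"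
      using sub by (intro inj_onI) (metis cell_index_cell_image lessThan_iff)
    then show "(\<Sum>e\<in>(\<lambda>e. cell K n a ` e) ` edges M. f e) = (\<Sum>e\<in>edges M. f (cell K n a ` e))"
      by (simp add: sum.reindex)
  qed
  finally show ?thesis .
qed

text \<open>Every edge lies inside one copy, so the exponent splits into one sum per copy and
  \<open>exp\<close> turns it into a product. The restriction matches the extensional functions in
  \<open>configurations M\<close>.\<close>

lemma weight_copies:
  assumes M: "simple_graph n (edges M)" "order M = n"
  shows "weight (copies K M) \<sigma> = (\<Prod>a<K. weight M (restrict (\<lambda>i. \<sigma> (cell K n a i)) {..<n}))"
proof -
  let ?r = "\<lambda>a. restrict (\<lambda>i. \<sigma> (cell K n a i)) {..<n}"
  have sub: "e \<subseteq> {..<n}" if "e \<in> edges M" for e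
    using M(1) that by (auto simp: simple_graph_def)
  have e: "(\<Sum>e\<in>edges (copies K M). beta (copies K M) e * of_bool (\<forall>u\<in>e. \<forall>v\<in>e. \<sigma> u = \<sigma> v))
     = (\<Sum>a<K. \<Sum>e\<in>edges M. beta M e * of_bool (\<forall>u\<in>e. \<forall>v\<in>e. ?r a u = ?r a v))"
    unfolding sum_edges_copies[OF M]
  proof (intro sum.cong refl)
    fix a e assume a: "a \<in> {..<K}" and e: "e \<in> edges M"
    have "(\<forall>u\<in>cell K n a ` e. \<forall>v\<in>cell K n a ` e. \<sigma> u = \<sigma> v) = (\<forall>u\<in>e. \<forall>v\<in>e. ?r a u = ?r a v)"
      using sub[OF e] by (auto simp: subset_eq)
    then show "beta (copies K M) (cell K n a ` e) *
        of_bool (\<forall>u\<in>cell K n a ` e. \<forall>v\<in>cell K n a ` e. \<sigma> u = \<sigma> v) =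
        beta M e * of_bool (\<forall>u\<in>e. \<forall>v\<in>e. ?r a u = ?r a v)"
      using a M(2) cell_index_cell_image[OF _ sub[OF e], of a K] by (simp add: copies_def)
  qed
  have o: "order (copies K M) = K * n" using M by (simp add: copies_def)
  have v: "(\<Sum>v<order (copies K M). field (copies K M) v (\<sigma> v)) = (\<Sum>a<K. \<Sum>i<n. field M i (?r a i))"
    unfolding o sum_cells using M(2) by (intro sum.cong refl) (auto simp: copies_def)
  show ?thesis
    unfolding weight_def e v using M(2) by (simp flip: exp_sum sum.distrib)
qed

lemma partition_function_copies:
  assumes M: "simple_graph n (edges M)" "order M = n"
  shows "partition_function (copies K M) = partition_function M ^ K"
proof -
  let ?C = "configurations M"
  have C: "?C = {..<n} \<rightarrow>\<^sub>E {1..spins M}" using M by (simp add: configurations_def)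
  have C': "configurations (copies K M) = {..<K * n} \<rightarrow>\<^sub>E {1..spins M}"
    using M by (simp add: configurations_def copies_def)
  have fin: "finite ?C" unfolding C by (intro finite_PiE) auto
  have "partition_function M ^ K = (\<Prod>a<K. \<Sum>\<tau>\<in>?C. weight M \<tau>)"
    by (simp add: partition_function_def)
  also have "\<dots> = (\<Sum>g\<in>{..<K} \<rightarrow>\<^sub>E ?C. \<Prod>a<K. weight M (g a))"
    using fin by (intro prod_sum_PiE) auto
  also have "\<dots> = (\<Sum>\<sigma>\<in>configurations (copies K M).
      \<Prod>a<K. weight M (restrict (\<lambda>i. \<sigma> (cell K n a i)) {..<n}))"
  \<comment> \<open>The expanded power is a sum over \<open>K\<close>-tuples of configurations of
    \<open>M\<close>: such a tuple is glued into one configuration of the union, and a configuration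
    is cut back into its pieces.\<close>
  proof (rule sum.reindex_bij_witness[where
        j = "\<lambda>g. restrict (\<lambda>v. g (cell_copy K n v) (cell_index K n v)) {..<K * n}" and
        i = "\<lambda>\<sigma>. restrict (\<lambda>a. restrict (\<lambda>i. \<sigma> (cell K n a i)) {..<n}) {..<K}"])
    fix g assume g: "g \<in> {..<K} \<rightarrow>\<^sub>E ?C"
    let ?\<sigma> = "restrict (\<lambda>v. g (cell_copy K n v) (cell_index K n v)) {..<K * n}"
    have r: "restrict (\<lambda>i. ?\<sigma> (cell K n a i)) {..<n} = g a" if "a < K" for a
    proof
      fix i
      have ga: "g a \<in> {..<n} \<rightarrow>\<^sub>E {1..spins M}" using g that C by auto
      show "restrict (\<lambda>i. ?\<sigma> (cell K n a i)) {..<n} i = g a i"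
        using that PiE_arb[OF ga, of i] by (cases "i < n") (auto simp: cell_less)
    qed
    show "restrict (\<lambda>a. restrict (\<lambda>i. ?\<sigma> (cell K n a i)) {..<n}) {..<K} = g"
    proof
      fix a
      show "restrict (\<lambda>a. restrict (\<lambda>i. ?\<sigma> (cell K n a i)) {..<n}) {..<K} a = g a"
        using r[of a] PiE_arb[OF g, of a] by (cases "a < K") auto
    qed
    show "?\<sigma> \<in> configurations (copies K M)"
      unfolding C'
    proof (rule restrict_PiE_iff[THEN iffD2], rule ballI)
      fix v assume "v \<in> {..<K * n}"
      then have "g (cell_copy K n v) \<in> {..<n} \<rightarrow>\<^sub>E {1..spins M}"
        using g C cell_copy_less by auto
      then show "g (cell_copy K n v) (cell_index K n v) \<in> {1..spins M}"
        using \<open>v \<in> _\<close> cell_index_less by blast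
    qed
    show "(\<Prod>a<K. weight M (restrict (\<lambda>i. ?\<sigma> (cell K n a i)) {..<n})) = (\<Prod>a<K. weight M (g a))"
      using r by (intro prod.cong) auto
  next
    fix \<sigma> assume s: "\<sigma> \<in> configurations (copies K M)"
    let ?g = "restrict (\<lambda>a. restrict (\<lambda>i. \<sigma> (cell K n a i)) {..<n}) {..<K}"
    show "restrict (\<lambda>v. ?g (cell_copy K n v) (cell_index K n v)) {..<K * n} = \<sigma>"
    proof
      fix v
      show "restrict (\<lambda>v. ?g (cell_copy K n v) (cell_index K n v)) {..<K * n} v = \<sigma> v"
        using PiE_arb[OF s[unfolded C'], of v]
        by (cases "v < K * n") (auto simp: cell_copy_less cell_index_less cell_cell_copy)
    qed
    show "?g \<in> {..<K} \<rightarrow>\<^sub>E ?C"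
      unfolding C using s[unfolded C'] cell_less by (auto simp: restrict_PiE_iff)
  qed
  also have "\<dots> = partition_function (copies K M)"
    unfolding partition_function_def weight_copies[OF M] ..
  finally show ?thesis by simp
qed

text \<open>There are \<open>q ^ n\<close> configurations, and the exponent of each weight is at
  most \<open>(|b| + h) * n ^ 2\<close> in absolute value. The bound is uniform over the family and
  limits the distance that the walk started at 0 has to cover.\<close>

lemma partition_function_bounds:
  assumes M: "M \<in> uniform_models q d b h n" and q: "q \<ge> 1" and n: "n \<ge> 1" and h: "h \<ge> 0"
  shows "partition_function M > 0"
    and "\<bar>ln (partition_function M)\<bar> \<le> (ln q + \<bar>b\<bar> + h) * real n ^ 2"
proof -
  have M: "spins M = q" "order M = n" "simple_graph n (edges M)"
    "\<And>v i. v < n \<Longrightarrow> i \<in> {1..q} \<Longrightarrow> \<bar>field M v i\<bar> \<le> h" "\<And>e. e \<in> edges M \<Longrightarrow> beta M e = b"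
    using assms by (auto simp: uniform_models_def bounded_models_def)
  let ?C = "configurations M" and ?B = "(\<bar>b\<bar> + h) * real n ^ 2"
  have C: "?C = {..<n} \<rightarrow>\<^sub>E {1..q}" using M by (simp add: configurations_def)
  have cardC: "card ?C = q ^ n" unfolding C by (simp add: card_PiE)
  have "edges M \<subseteq> (\<lambda>(u, v). {u, v}) ` ({..<n} \<times> {..<n})"
  proof
    fix e assume "e \<in> edges M"
    then have e: "e \<subseteq> {..<n}" "card e = 2" using M by (auto simp: simple_graph_def)
    then obtain u v where "e = {u, v}" by (meson card_2_iff)
    then show "e \<in> (\<lambda>(u, v). {u, v}) ` ({..<n} \<times> {..<n})" using e by auto
  qed
  then have "card (edges M) \<le> card ({..<n} \<times> {..<n})" by (rule surj_card_le[rotated]) auto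
  then have cardE: "real (card (edges M)) \<le> real n ^ 2"
    by (simp add: power2_eq_square flip: of_nat_mult)
  \<comment> \<open>This absorbs the contributions linear in \<open>n\<close>, from the fields and
    from \<open>ln (q ^ n)\<close>, into the quadratic bound.\<close>
  have nn: "real n \<le> real n ^ 2" using n by (simp add: power2_eq_square)
  have H: "exp (- ?B) \<le> weight M \<sigma> \<and> weight M \<sigma> \<le> exp ?B" if \<sigma>: "\<sigma> \<in> ?C" for \<sigma>
  proof -
    let ?X = "\<Sum>e\<in>edges M. beta M e * of_bool (\<forall>u\<in>e. \<forall>v\<in>e. \<sigma> u = \<sigma> v)"
      and ?Y = "\<Sum>v<order M. field M v (\<sigma> v)"
    have "\<bar>?X\<bar> \<le> (\<Sum>e\<in>edges M. \<bar>b\<bar>)"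
      using M(5) by (intro order_trans[OF sum_abs] sum_mono) (auto simp: abs_mult)
    also have "\<dots> \<le> real n ^ 2 * \<bar>b\<bar>" using cardE by (simp add: mult_right_mono)
    finally have X: "\<bar>?X\<bar> \<le> real n ^ 2 * \<bar>b\<bar>" .
    have "\<bar>?Y\<bar> \<le> (\<Sum>v<n. h)"
      unfolding M(2)
    proof (intro order_trans[OF sum_abs] sum_mono)
      fix v assume "v \<in> {..<n}"
      then show "\<bar>field M v (\<sigma> v)\<bar> \<le> h"
        using \<sigma> by (intro M(4)) (auto simp: C PiE_iff)
    qed
    also have "\<dots> \<le> real n ^ 2 * h" using nn h by (simp add: mult_right_mono)
    finally have Y: "\<bar>?Y\<bar> \<le> real n ^ 2 * h" .
    have "\<bar>?X + ?Y\<bar> \<le> ?B" using X Y by (simp add: algebra_simps)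
    then show ?thesis unfolding weight_def by (simp add: abs_le_iff)
  qed
  have lo: "real q ^ n * exp (- ?B) \<le> partition_function M"
    using sum_bounded_below[of ?C "exp (- ?B)" "weight M"] H
    by (simp add: cardC partition_function_def)
  have hi: "partition_function M \<le> real q ^ n * exp ?B"
    using sum_bounded_above[of ?C "weight M" "exp ?B"] H
    by (simp add: cardC partition_function_def)
  have qn: "real q ^ n > 0" using q by simp
  have "0 < real q ^ n * exp (- ?B)" using qn by simp
  with lo show pos: "partition_function M > 0" by linarith
  have lnq: "ln (real q ^ n * exp y) = real n * ln q + y" for y
    using q by (simp add: ln_mult ln_realpow)
  have "real n * ln q - ?B \<le> ln (partition_function M)"
    using lo pos qn lnq[of "- ?B"] by (metis ln_mono exp_gt_zero mult_pos_pos diff_conv_add_uminus)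
  moreover have "ln (partition_function M) \<le> real n * ln q + ?B"
    using hi pos qn lnq[of ?B] by (metis ln_mono)
  moreover have "real n * ln q \<le> real n ^ 2 * ln q" "0 \<le> real n * ln q"
    using q nn by (auto intro: mult_right_mono)
  ultimately show "\<bar>ln (partition_function M)\<bar> \<le> (ln q + \<bar>b\<bar> + h) * real n ^ 2"
    by (simp add: algebra_simps)
qed

text \<open>Position \<open>v\<close> of the reversed list is position \<open>K * n - 1 - v\<close>
  of the list itself, and quotient and remainder of that number by \<open>n\<close> are
  \<open>cell_copy\<close> and \<open>cell_index\<close>.\<close>

lemma rev_concat_cells:
  assumes "length js = K"
  shows "rev (concat (map (\<lambda>j. map (f j) [0..<n]) js))
    = map (\<lambda>v. f (js ! cell_copy K n v) (cell_index K n v)) [0..<K * n]"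
proof -
  have "concat (map (\<lambda>j. map (f j) [0..<n]) js)
      = map (\<lambda>t. f (js ! (t div n)) (t mod n)) [0..<length js * n]"
  proof (induction js rule: rev_induct)
    case Nil
    show ?case by simp
  next
    case (snoc j js)
    have "map (\<lambda>t. f ((js @ [j]) ! (t div n)) (t mod n)) [0..<length (js @ [j]) * n]
      = map (\<lambda>t. f ((js @ [j]) ! (t div n)) (t mod n)) ([0..<length js * n] @ [length js * n..<length js * n + n])"
      using upt_add_eq_append[of 0 "length js * n" n] by (simp add: add.commute)
    also have "\<dots> = map (\<lambda>t. f (js ! (t div n)) (t mod n)) [0..<length js * n] @ map (f j) [0..<n]"
      unfolding map_append
    proof (intro arg_cong2[where f = "(@)"])
      show "map (\<lambda>t. f ((js @ [j]) ! (t div n)) (t mod n)) [0..<length js * n]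
        = map (\<lambda>t. f (js ! (t div n)) (t mod n)) [0..<length js * n]"
        by (auto simp: nth_append less_mult_imp_div_less)
      show "map (\<lambda>t. f ((js @ [j]) ! (t div n)) (t mod n)) [length js * n..<length js * n + n]
        = map (f j) [0..<n]"
        by (rule nth_equalityI) auto
    qed
    finally show ?case using snoc by simp
  qed
  then show ?thesis
    unfolding assms by (simp only:) (auto intro!: nth_equalityI simp: rev_nth cell_copy_def cell_index_def)
qed

text \<open>The right-hand side is what the nested loops of the algorithm accumulate. The entries of
  \<open>js\<close> are labels of the copies; as they are distinct, equality of labels decides
  whether two vertices lie in the same copy.\<close>

lemma encode_copies:
  assumes M: "simple_graph n (edges M)" "order M = n" and js: "length js = K" "distinct js"
  shows "encode (copies K M) = encode_list (rev (concat (map (\<lambda>j. map (\<lambda>v.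
      Pair (left (encode_vertex M v)) (encode_list (rev (concat (map (\<lambda>j'. map (\<lambda>e. if j = j' then e else Nul)
        (map (\<lambda>u. if {u, v} \<in> edges M then Atom (beta M {u, v}) else Nul) [0..<n])) js)))))
      [0..<n]) js)))"
proof -
  have nth_eq: "js ! cell_copy K n v = js ! cell_copy K n u \<longleftrightarrow> cell_copy K n u = cell_copy K n v"
    if "u < K * n" "v < K * n" for u v
    using that js cell_copy_less[of u K n] cell_copy_less[of v K n] by (auto simp: nth_eq_iff_index_eq)
  show ?thesis
    unfolding map_map o_def rev_concat_cells[OF js(1)] encode_def
  proof (intro arg_cong[where f = encode_list] nth_equalityI, goal_cases)
    case 1
    then show ?case using M by (simp add: copies_def)
  next
    case (2 v)
    then have v: "v < K * n" using M by (simp add: copies_def)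
    \<comment> \<open>By \<open>edges_copies_iff\<close>, entries between different copies are
      \<open>Nul\<close> and the remaining ones are those of \<open>M\<close>.\<close>
    have "map (\<lambda>u. if {u, v} \<in> edges (copies K M) then Atom (beta (copies K M) {u, v}) else Nul) [0..<K * n]
      = map (\<lambda>u. if js ! cell_copy K n v = js ! cell_copy K n u then
           if {cell_index K n u, cell_index K n v} \<in> edges M
           then Atom (beta M {cell_index K n u, cell_index K n v}) else Nul else Nul) [0..<K * n]"
      using v M by (intro map_cong refl) (simp add: edges_copies_iff nth_eq)
    then show ?case using v M
      by (simp add: encode_vertex_def del: upt_Suc map_eq_conv cong: if_cong)
  qed
qed

section \<open>A biased random walk\<close>

text \<open>At distance at least 1 from the target a step is in the right direction with probability at least
  5/8, which multiplies the dominant term by at most \<open>5/8 * 3/4 + 3/8 * 4/3 = 31/32\<close> on average.\<close>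

definition potential :: "real \<Rightarrow> real" where
  "potential x = (4/3) powr x + (4/3) powr (- x)"

lemma potential_nonneg: "potential x \<ge> 0"
  by (simp add: potential_def)

lemma potential_ge: "potential x \<ge> (4/3) powr \<bar>x\<bar>"
  by (cases "x \<ge> 0") (auto simp: potential_def)

lemma potential_le: "potential x \<le> 2 * (4/3) powr \<bar>x\<bar>"
proof -
  have "(4/3) powr x \<le> (4/3 :: real) powr \<bar>x\<bar>" "(4/3) powr (- x) \<le> (4/3 :: real) powr \<bar>x\<bar>"
    by (intro powr_mono; simp)+
  then show ?thesis unfolding potential_def by linarith
qed

lemma potential_step:
  assumes u: "0 \<le> u" "u \<le> 1" and hi: "x \<ge> 1 \<Longrightarrow> u \<le> 3/8" and lo: "x \<le> -1 \<Longrightarrow> u \<ge> 5/8"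
  shows "u * potential (x + 1) + (1 - u) * potential (x - 1) \<le> 31/32 * potential x + 1"
proof -
  define P Q where "P = (4/3 :: real) powr x" and "Q = (4/3 :: real) powr (- x)"
  have pos: "P > 0" "Q > 0" by (auto simp: P_def Q_def)
  have pot: "potential x = P + Q" "potential (x + 1) = 4/3 * P + 3/4 * Q" "potential (x - 1) = 3/4 * P + 4/3 * Q"
    by (auto simp: potential_def P_def Q_def powr_add powr_diff powr_minus field_simps)
  consider "x \<ge> 1" | "x \<le> -1" | "- 1 < x" "x < 1" by linarith
  then show ?thesis
  proof cases
    case 1
    have "(4/3) powr 1 \<le> P" unfolding P_def using 1 by (intro powr_mono) auto
    moreover have "Q \<le> (4/3) powr (- 1)" unfolding Q_def using 1 by (intro powr_mono) auto
    ultimately have PQ: "P \<ge> 4/3" "Q \<le> 3/4" by (auto simp: powr_minus)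
    \<comment> \<open>The left side is affine in \<open>u\<close> with slope
      \<open>7/12 * (P - Q)\<close>, and \<open>w\<close> measures the gain over the worst case
      \<open>u = 3/8\<close>, where the coefficients are 31/32 and 107/96. The excess of 107/96 over
      31/32, times \<open>Q \<le> 3/4\<close>, is below 1.\<close>
    define w where "w = (3/8 - u) * (P - Q)"
    have "w \<ge> 0" unfolding w_def using hi[OF 1] PQ by (intro mult_nonneg_nonneg) auto
    moreover have eq: "u * (4/3 * P + 3/4 * Q) + (1 - u) * (3/4 * P + 4/3 * Q)
        = 31/32 * P + 107/96 * Q - 7/12 * w"
      by (simp add: w_def field_simps)
    ultimately show ?thesis unfolding pot eq using PQ pos by argo
  next
    case 2
    have "(4/3) powr 1 \<le> Q" unfolding Q_def using 2 by (intro powr_mono) auto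
    moreover have "P \<le> (4/3) powr (- 1)" unfolding P_def using 2 by (intro powr_mono) auto
    ultimately have PQ: "Q \<ge> 4/3" "P \<le> 3/4" by (auto simp: powr_minus)
    \<comment> \<open>Mirror image of the first case, with worst case
      \<open>u = 5/8\<close>.\<close>
    define w where "w = (u - 5/8) * (Q - P)"
    have "w \<ge> 0" unfolding w_def using lo[OF 2] PQ by (intro mult_nonneg_nonneg) auto
    moreover have eq: "u * (4/3 * P + 3/4 * Q) + (1 - u) * (3/4 * P + 4/3 * Q)
        = 31/32 * Q + 107/96 * P - 7/12 * w"
      by (simp add: w_def field_simps)
    ultimately show ?thesis unfolding pot eq using PQ pos by argo
  next
    case 3
    \<comment> \<open>Near the target the answers carry no guarantee. The potential grows at most by
      the factor 4/3, and since \<open>P + Q \<le> 8/3\<close> the additive 1 pays for it: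
      \<open>(4/3 - 31/32) * 8/3 < 1\<close>.\<close>
    have "P \<le> (4/3) powr 1" unfolding P_def using 3 by (intro powr_mono) auto
    moreover have "Q \<le> (4/3) powr 1" unfolding Q_def using 3 by (intro powr_mono) auto
    ultimately have PQ: "P \<le> 4/3" "Q \<le> 4/3" by auto
    have "u * (4/3 * P + 3/4 * Q) \<le> u * (4/3 * (P + Q))" using u pos by (intro mult_left_mono) auto
    moreover have "(1 - u) * (3/4 * P + 4/3 * Q) \<le> (1 - u) * (4/3 * (P + Q))"
      using u pos by (intro mult_left_mono) auto
    ultimately have "u * (4/3 * P + 3/4 * Q) + (1 - u) * (3/4 * P + 4/3 * Q) \<le> 4/3 * (P + Q)"
      by (simp add: algebra_simps)
    also have "\<dots> \<le> 31/32 * (P + Q) + 1" using PQ by argo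
    finally show ?thesis unfolding pot .
  qed
qed

text \<open>Since \<open>(31/32) ^ 10 \<le> 3/4\<close>, ten steps cancel the factor 4/3 that one
  unit of initial distance contributes to the potential.\<close>

lemma potential_decay:
  assumes "10 * \<bar>x\<bar> \<le> real N"
  shows "(31/32) ^ N * potential x \<le> 2"
proof -
  have "(31/32 :: real) ^ N = (31/32) powr real N" by (simp add: powr_realpow)
  also have "\<dots> \<le> (31/32) powr (10 * \<bar>x\<bar>)" using assms by (intro powr_mono') auto
  also have "\<dots> = ((31/32) powr 10) powr \<bar>x\<bar>" unfolding powr_powr ..
  also have "\<dots> \<le> (3/4) powr \<bar>x\<bar>"
    by (intro powr_mono2) (auto simp: powr_numeral power_divide)
  finally have "(31/32) ^ N * potential x \<le> (3/4) powr \<bar>x\<bar> * (2 * (4/3) powr \<bar>x\<bar>)"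
    using potential_le[of x] potential_nonneg[of x] by (intro mult_mono) auto
  also have "\<dots> = 2 * (3/4 * (4/3)) powr \<bar>x\<bar>" by (subst powr_mult) auto
  finally show ?thesis by simp
qed

section \<open>The approximation algorithm\<close>

definition frame :: "nat set \<Rightarrow> store \<Rightarrow> store \<Rightarrow> bool" where
  "frame V s s' \<longleftrightarrow> (\<forall>x. x \<notin> V \<longrightarrow> s' x = s x)"

lemma frame_refl [simp]: "frame V s s"
  by (simp add: frame_def)

text \<open>Each query has to start as in \<open>run\<close>, with \<open>Nul\<close> in all
  variables of the subroutine except 0, so leftovers of the previous query are erased.\<close>

primrec clear :: "nat \<Rightarrow> com" where
  "clear 0 = Skip"
| "clear (Suc j) = Seq (clear j) (Assign (Suc j) NulE)"

lemma det_clear: "det (clear j) s (2 * j) (\<lambda>x. if 1 \<le> x \<and> x \<le> j then Nul else s x)"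
proof (induction j)
  case 0
  have "(\<lambda>x. if 1 \<le> x \<and> x \<le> 0 then Nul else s x) = s" by auto
  then show ?case by (simp add: det_def)
next
  case (Suc j)
  have "(\<lambda>x. if 1 \<le> x \<and> x \<le> j then Nul else s x)(Suc j := Nul)
      = (\<lambda>x. if 1 \<le> x \<and> x \<le> Suc j then Nul else s x)" by auto
  then show ?case
    using det_Seq[OF Suc det_Assign[of "Suc j" NulE]] by simp
qed

context
  fixes m :: nat
begin

text \<open>All working variables lie above the range \<open>{..<m}\<close> in which the subroutine
  operates.\<close>

abbreviation (input) "v_rho \<equiv> m + 15"
abbreviation (input) "v_model \<equiv> m + 16"
abbreviation (input) "v_n \<equiv> m + 17"
abbreviation (input) "v_copies \<equiv> m + 3"
abbreviation (input) "v_K \<equiv> m + 4"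
abbreviation (input) "v_a \<equiv> m + 5"
abbreviation (input) "v_b \<equiv> m + 6"
abbreviation (input) "v_c \<equiv> m + 7"
abbreviation (input) "v_d \<equiv> m + 8"
abbreviation (input) "v_row \<equiv> m + 9"
abbreviation (input) "v_out \<equiv> m + 10"
abbreviation (input) "v_ratio \<equiv> m + 11"
abbreviation (input) "v_y \<equiv> m + 12"
abbreviation (input) "v_i \<equiv> m + 13"
abbreviation (input) "v_lim \<equiv> m + 14"

text \<open>The only comparison is \<open>Less\<close>, so equality of the copy labels of row and
  column is tested by two comparisons.\<close>

definition copy_entry :: com where
  "copy_entry = Cond (Less (Fst (Var v_a)) (Fst (Var v_c))) (Assign v_row (PairE NulE (Var v_row)))
     (Cond (Less (Fst (Var v_c)) (Fst (Var v_a))) (Assign v_row (PairE NulE (Var v_row)))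
       (Assign v_row (PairE (Fst (Var v_d)) (Var v_row))))"

definition copy_entries :: com where
  "copy_entries = foreach v_d copy_entry"

text \<open>Of the four nested loops, those over \<open>v_a\<close> and \<open>v_b\<close> choose
  copy and vertex of the row, those over \<open>v_c\<close> and \<open>v_d\<close> copy and entry of
  the column. Consing onto \<open>v_row\<close> and \<open>v_out\<close> reverses the order, in
  agreement with \<open>cell\<close>.\<close>

definition copy_row :: com where
  "copy_row = Seq (Assign v_row NulE) (Seq (Assign v_c (Var v_copies))
     (foreach v_c (Seq (Assign v_d (Snd (Fst (Var v_b)))) copy_entries)))"

definition copy_block :: com where
  "copy_block = foreach v_b (Seq copy_row
     (Assign v_out (PairE (PairE (Fst (Fst (Var v_b))) (Var v_row)) (Var v_out))))"

definition copy_all :: com where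
  "copy_all = Seq (Assign v_out NulE) (Seq (Assign v_a (Var v_copies))
     (foreach v_a (Seq (Assign v_b (Var v_model)) copy_block)))"

text \<open>The encoding does not store the number of vertices, on which the loop limits and the
  ratio depend.\<close>

definition count_vertices :: com where
  "count_vertices = Seq (Assign v_n (Const 0)) (Seq (Assign v_a (Var v_model))
     (foreach v_a (Assign v_n (Add (Var v_n) (Const 1)))))"

text \<open>In the absence of a rounding operation, counting up while below the limit produces its
  ceiling. The values passed on the way become the distinct copy labels.\<close>

definition make_counter :: com where
  "make_counter = Seq (Assign v_copies NulE) (Seq (Assign v_K (Const 0))
     (While (Less (Var v_K) (Var v_lim)) (Seq (Assign v_copies (PairE (Var v_K) (Var v_copies)))
       (Assign v_K (Add (Var v_K) (Const 1))))))"

section \<open>Correctness and running time of the copying programs\<close>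

lemma det_copy_entry:
  assumes "s v_a = Pair (Atom j) x" "s v_c = Pair (Atom j') y"
  shows "det copy_entry s 3 (s(v_row := Pair (if j = j' then left (s v_d) else Nul) (s v_row)))"
proof -
  consider "j < j'" | "j' < j" | "j = j'" by linarith
  then have "det copy_entry s (Suc (Suc 1)) (s(v_row := Pair (if j = j' then left (s v_d) else Nul) (s v_row)))"
  proof cases
    case 1
    then show ?thesis
      using assms det_mono[OF det_Assign[of v_row "PairE NulE (Var v_row)" s], of "Suc 1"]
      unfolding copy_entry_def by (intro det_Cond) (simp add: truth_def)
  next
    case 2
    then show ?thesis
      using assms det_Cond[of "Less (Fst (Var v_c)) (Fst (Var v_a))" s _ _ 1] det_Assign[of v_row "PairE NulE (Var v_row)" s]
      unfolding copy_entry_def by (intro det_Cond) (simp add: truth_def)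
  next
    case 3
    then show ?thesis
      using assms det_Cond[of "Less (Fst (Var v_c)) (Fst (Var v_a))" s _ _ 1] det_Assign[of v_row "PairE (Fst (Var v_d)) (Var v_row)" s]
      unfolding copy_entry_def by (intro det_Cond) (simp add: truth_def)
  qed
  then show ?thesis by (simp add: numeral_3_eq_3)
qed

lemma det_copy_entries:
  assumes s: "s v_a = Pair (Atom j) x" "s v_c = Pair (Atom j') y"
    "s v_d = encode_list es" "s v_row = encode_list r"
  shows "\<exists>s'. det copy_entries s (length es * 7 + 1) s' \<and> frame {v_d, v_row} s s'
    \<and> s' v_row = encode_list (rev (map (\<lambda>e. if j = j' then e else Nul) es) @ r)"
proof -
  let ?f = "\<lambda>e. if j = j' then e else Nul"
  let ?I = "\<lambda>ys s'. frame {v_d, v_row} s s' \<and> s' v_row = encode_list (rev (map ?f ys) @ r)"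
  have "\<exists>s'. det (foreach v_d copy_entry) s (length es * (3 + 4) + 1) s' \<and> ?I es s'"
  proof (rule det_foreach[where F = "\<lambda>x. x"])
    fix ys e zs s1
    assume I: "?I ys s1" and d: "s1 v_d = Pair e (encode_list (map (\<lambda>x. x) zs))"
    have "s1 v_a = Pair (Atom j) x" "s1 v_c = Pair (Atom j') y"
      using I s by (auto simp: frame_def)
    from det_copy_entry[OF this]
    show "\<exists>s'. det copy_entry s1 3 s' \<and> s' v_d = s1 v_d \<and> ?I (ys @ [e]) s'"
      using I d by (intro exI[of _ "s1(v_row := Pair (if j = j' then left (s1 v_d) else Nul) (s1 v_row))"])
        (auto simp: frame_def)
  qed (use s in \<open>auto simp: frame_def\<close>)
  then show ?thesis unfolding copy_entries_def by simp
qed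

text \<open>The row left by the two inner loops, in the form in which it occurs in
  \<open>encode_copies\<close>.\<close>

definition copied_row :: "real list \<Rightarrow> real \<Rightarrow> val list \<Rightarrow> val" where
  "copied_row js j es
    = encode_list (rev (concat (map (\<lambda>j'. map (\<lambda>e. if j = j' then e else Nul) es) js)))"

lemma det_copy_row:
  assumes s: "s v_a = Pair (Atom j) x" "s v_b = Pair (Pair fl (encode_list es)) y"
    "s v_copies = encode_list (map Atom js)"
  shows "\<exists>s'. det copy_row s (length js * (length es * 7 + 7) + 5) s' \<and> frame {v_c, v_d, v_row} s s'
    \<and> s' v_row = copied_row js j es"
proof -
  let ?I = "\<lambda>ys s'. frame {v_c, v_d, v_row} s s' \<and> s' v_row = copied_row ys j es"
  let ?body = "Seq (Assign v_d (Snd (Fst (Var v_b)))) copy_entries"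
  let ?s = "s(v_row := Nul, v_c := encode_list (map Atom js))"
  have "\<exists>s'. det (foreach v_c ?body) ?s (length js * ((length es * 7 + 3) + 4) + 1) s' \<and> ?I js s'"
  proof (rule det_foreach[where F = Atom])
    fix ys j' zs s1
    assume I: "?I ys s1" and c: "s1 v_c = Pair (Atom j') (encode_list (map Atom zs))"
    let ?s1 = "s1(v_d := encode_list es)"
    have "?s1 v_a = Pair (Atom j) x" "?s1 v_c = Pair (Atom j') (encode_list (map Atom zs))"
      "?s1 v_d = encode_list es"
      "?s1 v_row = encode_list (rev (concat (map (\<lambda>j'. map (\<lambda>e. if j = j' then e else Nul) es) ys)))"
      using I c s by (auto simp: frame_def copied_row_def)
    from det_copy_entries[of ?s1, OF this] obtain s2 where s2:
      "det copy_entries ?s1 (length es * 7 + 1) s2" "frame {v_d, v_row} ?s1 s2"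
      "s2 v_row = copied_row (ys @ [j']) j es"
      by (auto simp: copied_row_def)
    have "evaluate (Snd (Fst (Var v_b))) s1 = encode_list es"
      using I s by (auto simp: frame_def)
    then have "det (Assign v_d (Snd (Fst (Var v_b)))) s1 1 ?s1"
      by (metis det_Assign)
    from det_Seq[OF this s2(1)] have "det ?body s1 (length es * 7 + 3) s2"
      by (rule det_mono) simp
    then show "\<exists>s'. det ?body s1 (length es * 7 + 3) s' \<and> s' v_c = s1 v_c \<and> ?I (ys @ [j']) s'"
      using I s2 by (intro exI[of _ s2]) (auto simp: frame_def)
  qed (use s in \<open>auto simp: frame_def copied_row_def\<close>)
  then obtain s' where s': "det (foreach v_c ?body) ?s (length js * ((length es * 7 + 3) + 4) + 1) s'"
    "?I js s'" by blast
  have "det (Seq (Assign v_c (Var v_copies)) (foreach v_c ?body)) (s(v_row := Nul))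
      (1 + (length js * ((length es * 7 + 3) + 4) + 1) + 1) s'"
    using det_Assign[of v_c "Var v_copies" "s(v_row := Nul)"] s(3) s'(1) by (intro det_Seq) auto
  from det_Seq[OF det_Assign[of v_row NulE s, simplified] this]
  have "det copy_row s (length js * (length es * 7 + 7) + 5) s'"
    unfolding copy_row_def by (rule det_mono) (simp add: algebra_simps)
  then show ?thesis using s'(2) by blast
qed

lemma det_copy_block:
  assumes s: "s v_a = Pair (Atom j) x" "s v_b = encode_list (map (\<lambda>v. Pair (fl v) (encode_list (es v))) vs)"
    "s v_copies = encode_list (map Atom js)" "s v_out = encode_list r"
    and len: "\<And>v. length (es v) = n"
  shows "\<exists>s'. det copy_block s (length vs * (length js * (n * 7 + 7) + 11) + 1) s'
    \<and> frame {v_b, v_c, v_d, v_row, v_out} s s'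
    \<and> s' v_out = encode_list (rev (map (\<lambda>v. Pair (fl v) (copied_row js j (es v))) vs) @ r)"
proof -
  let ?I = "\<lambda>ys s'. frame {v_b, v_c, v_d, v_row, v_out} s s'
    \<and> s' v_out = encode_list (rev (map (\<lambda>v. Pair (fl v) (copied_row js j (es v))) ys) @ r)"
  let ?out = "PairE (PairE (Fst (Fst (Var v_b))) (Var v_row)) (Var v_out)"
  let ?t = "length js * (n * 7 + 7) + 7"
  have "\<exists>s'. det copy_block s (length vs * (?t + 4) + 1) s' \<and> ?I vs s'"
    unfolding copy_block_def
  proof (rule det_foreach[where F = "\<lambda>v. Pair (fl v) (encode_list (es v))"])
    fix ys y zs s1
    assume I: "?I ys s1" and b: "s1 v_b = Pair (Pair (fl y) (encode_list (es y)))
      (encode_list (map (\<lambda>v. Pair (fl v) (encode_list (es v))) zs))"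
    have "s1 v_a = Pair (Atom j) x" "s1 v_copies = encode_list (map Atom js)"
      using I s by (auto simp: frame_def)
    from det_copy_row[OF this(1) b this(2)] obtain s2 where s2:
      "det copy_row s1 (length js * (n * 7 + 7) + 5) s2" "frame {v_c, v_d, v_row} s1 s2"
      "s2 v_row = copied_row js j (es y)"
      by (auto simp: len)
    have b2: "s2 v_b = s1 v_b" "s2 v_out = s1 v_out" using s2(2) by (auto simp: frame_def)
    have "det (Seq copy_row (Assign v_out ?out)) s1 ?t (s2(v_out := evaluate ?out s2))"
      by (rule det_mono[OF det_Seq[OF s2(1) det_Assign]]) simp
    moreover have "?I (ys @ [y]) (s2(v_out := evaluate ?out s2))"
      using I b b2 s2 by (auto simp: frame_def)
    ultimately show "\<exists>s'. det (Seq copy_row (Assign v_out ?out)) s1 ?t s' \<and> s' v_b = s1 v_b \<and> ?I (ys @ [y]) s'"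
      using b2 by (intro exI[of _ "s2(v_out := evaluate ?out s2)"]) auto
  qed (use s in \<open>auto simp: frame_def\<close>)
  then show ?thesis by (simp add: add.assoc)
qed

text \<open>The accumulator ends with the shape required by \<open>encode_copies\<close>. Each of
  the \<open>length js * length vs\<close> new vertices gets a full adjacency row, whence the
  quadratic dependence on \<open>length js\<close>.\<close>

lemma det_copy_all:
  assumes s: "s v_model = encode_list (map (\<lambda>v. Pair (fl v) (encode_list (es v))) vs)"
    "s v_copies = encode_list (map Atom js)"
    and len: "\<And>v. length (es v) = n"
  shows "\<exists>s'. det copy_all s (length js * (length vs * (length js * (n * 7 + 7) + 11) + 7) + 5) s'
    \<and> frame {v_a, v_b, v_c, v_d, v_row, v_out} s s'
    \<and> s' v_out = encode_list (rev (concat (map (\<lambda>j. map (\<lambda>v. Pair (fl v) (copied_row js j (es v))) vs) js)))"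
proof -
  let ?f = "\<lambda>j. map (\<lambda>v. Pair (fl v) (copied_row js j (es v))) vs"
  let ?I = "\<lambda>ys s'. frame {v_a, v_b, v_c, v_d, v_row, v_out} s s'
    \<and> s' v_out = encode_list (rev (concat (map ?f ys)))"
  let ?body = "Seq (Assign v_b (Var v_model)) copy_block"
  let ?t = "length vs * (length js * (n * 7 + 7) + 11) + 3"
  let ?s = "s(v_out := Nul, v_a := encode_list (map Atom js))"
  have "\<exists>s'. det (foreach v_a ?body) ?s (length js * (?t + 4) + 1) s' \<and> ?I js s'"
  proof (rule det_foreach[where F = Atom and I = ?I])
    fix ys j zs s1
    assume I: "?I ys s1" and a: "s1 v_a = Pair (Atom j) (encode_list (map Atom zs))"
    let ?s1 = "s1(v_b := encode_list (map (\<lambda>v. Pair (fl v) (encode_list (es v))) vs))"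
    have "?s1 v_a = Pair (Atom j) (encode_list (map Atom zs))"
      "?s1 v_b = encode_list (map (\<lambda>v. Pair (fl v) (encode_list (es v))) vs)"
      "?s1 v_copies = encode_list (map Atom js)" "?s1 v_out = encode_list (rev (concat (map ?f ys)))"
      using I a s by (auto simp: frame_def)
    from det_copy_block[of ?s1, OF this len] obtain s2 where s2:
      "det copy_block ?s1 (length vs * (length js * (n * 7 + 7) + 11) + 1) s2"
      "frame {v_b, v_c, v_d, v_row, v_out} ?s1 s2"
      "s2 v_out = encode_list (rev (?f j) @ rev (concat (map ?f ys)))"
      by auto
    have "evaluate (Var v_model) s1 = encode_list (map (\<lambda>v. Pair (fl v) (encode_list (es v))) vs)"
      using I s by (auto simp: frame_def)
    then have "det (Assign v_b (Var v_model)) s1 1 ?s1"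
      by (metis det_Assign)
    from det_Seq[OF this s2(1)] have "det ?body s1 ?t s2"
      by (rule det_mono) simp
    then show "\<exists>s'. det ?body s1 ?t s' \<and> s' v_a = s1 v_a \<and> ?I (ys @ [j]) s'"
      using I s2 by (intro exI[of _ s2]) (auto simp: frame_def)
  qed (use s in \<open>auto simp: frame_def\<close>)
  then obtain s' where s': "det (foreach v_a ?body) ?s (length js * (?t + 4) + 1) s'"
    "?I js s'" by blast
  have "det (Seq (Assign v_a (Var v_copies)) (foreach v_a ?body)) (s(v_out := Nul))
      (1 + (length js * (?t + 4) + 1) + 1) s'"
    using det_Assign[of v_a "Var v_copies" "s(v_out := Nul)"] s(2) s'(1) by (intro det_Seq) auto
  from det_Seq[OF det_Assign[of v_out NulE s, simplified] this]
  have "det copy_all s (length js * (?t + 4) + 5) s'"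
    unfolding copy_all_def by (rule det_mono) simp
  then show ?thesis using s'(2) by (auto simp: add.assoc)
qed

lemma det_count_vertices:
  assumes s: "s v_model = encode_list vs"
  shows "\<exists>s'. det count_vertices s (length vs * 5 + 5) s' \<and> frame {v_a, v_n} s s'
    \<and> s' v_n = Atom (real (length vs))"
proof -
  let ?I = "\<lambda>ys s'. frame {v_a, v_n} s s' \<and> s' v_n = Atom (real (length ys))"
  let ?body = "Assign v_n (Add (Var v_n) (Const 1))"
  let ?s = "s(v_n := Atom 0, v_a := encode_list vs)"
  have "\<exists>s'. det (foreach v_a ?body) ?s (length vs * (1 + 4) + 1) s' \<and> ?I vs s'"
  proof (rule det_foreach[where F = "\<lambda>x. x"])
    fix ys y zs s1
    assume I: "?I ys s1"
    show "\<exists>s'. det ?body s1 1 s' \<and> s' v_a = s1 v_a \<and> ?I (ys @ [y]) s'"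
      using I det_Assign[of v_n "Add (Var v_n) (Const 1)" s1]
      by (intro exI[of _ "s1(v_n := Atom (real (length ys) + 1))"]) (auto simp: frame_def add.commute)
  qed (use s in \<open>auto simp: frame_def\<close>)
  then obtain s' where s': "det (foreach v_a ?body) ?s (length vs * (1 + 4) + 1) s'" "?I vs s'"
    by blast
  have "det (Seq (Assign v_a (Var v_model)) (foreach v_a ?body)) (s(v_n := Atom 0))
      (1 + (length vs * (1 + 4) + 1) + 1) s'"
    using det_Assign[of v_a "Var v_model" "s(v_n := Atom 0)"] s s'(1) by (intro det_Seq) auto
  from det_Seq[OF det_Assign[of v_n "Const 0" s, simplified] this]
  have "det count_vertices s (length vs * 5 + 5) s'"
    unfolding count_vertices_def by (rule det_mono) simp
  then show ?thesis using s'(2) by blast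
qed

text \<open>A loop counting up from 0 while below a real limit therefore makes exactly
  \<open>nat \<lceil>x\<rceil>\<close> iterations, also for a negative limit.\<close>

lemma less_nat_ceiling_iff: "k < nat \<lceil>x\<rceil> \<longleftrightarrow> real k < x"
  by (simp add: zless_nat_eq_int_zless less_ceiling_iff)

lemma det_make_counter:
  assumes s: "s v_lim = Atom l" and K: "K = nat \<lceil>l\<rceil>"
  shows "\<exists>s'. det make_counter s (K * 5 + 5) s' \<and> frame {v_copies, v_K} s s'
    \<and> s' v_K = Atom (real K) \<and> s' v_copies = encode_list (map Atom (map real (rev [0..<K])))"
proof -
  let ?I = "\<lambda>k s'. frame {v_copies, v_K} s s' \<and> s' v_K = Atom (real k)
    \<and> s' v_copies = encode_list (map Atom (map real (rev [0..<k])))"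
  let ?body = "Seq (Assign v_copies (PairE (Var v_K) (Var v_copies))) (Assign v_K (Add (Var v_K) (Const 1)))"
  let ?W = "While (Less (Var v_K) (Var v_lim)) ?body"
  let ?s = "s(v_copies := Nul, v_K := Atom 0)"
  have "\<exists>s'. det ?W ?s (K * (3 + 2) + 1) s' \<and> ?I K s'"
  proof (rule det_while)
    fix k s1 assume k: "k < K" and I: "?I k s1"
    have "s1 v_lim = Atom l" using I s by (auto simp: frame_def)
    then have "evaluate (Less (Var v_K) (Var v_lim)) s1 \<noteq> Nul"
      using I k K by (auto simp: truth_def less_nat_ceiling_iff)
    moreover have "det ?body s1 3 (s1(v_copies := Pair (Atom (real k)) (s1 v_copies), v_K := Atom (real (Suc k))))"
      using det_Seq[OF det_Assign[of v_copies "PairE (Var v_K) (Var v_copies)" s1] det_Assign[of v_K "Add (Var v_K) (Const 1)"]] I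
      by (simp add: add.commute numeral_3_eq_3)
    ultimately show "evaluate (Less (Var v_K) (Var v_lim)) s1 \<noteq> Nul \<and> (\<exists>s'. det ?body s1 3 s' \<and> ?I (Suc k) s')"
      using I by (intro conjI exI[of _ "s1(v_copies := Pair (Atom (real k)) (s1 v_copies), v_K := Atom (real (Suc k)))"])
        (auto simp: frame_def)
  next
    fix s1 assume I: "?I K s1"
    have "s1 v_lim = Atom l" using I s by (auto simp: frame_def)
    then show "evaluate (Less (Var v_K) (Var v_lim)) s1 = Nul"
      using I K less_nat_ceiling_iff[of K l] by (auto simp: truth_def)
  qed (auto simp: frame_def)
  then obtain s' where s': "det ?W ?s (K * (3 + 2) + 1) s'" "?I K s'" by blast
  have "det (Seq (Assign v_K (Const 0)) ?W) (s(v_copies := Nul)) (1 + (K * (3 + 2) + 1) + 1) s'"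
    using det_Assign[of v_K "Const 0" "s(v_copies := Nul)"] s'(1) by (intro det_Seq) auto
  from det_Seq[OF det_Assign[of v_copies NulE s, simplified] this]
  have "det make_counter s (K * 5 + 5) s'"
    unfolding make_counter_def by (rule det_mono) simp
  then show ?thesis using s'(2) by blast
qed

text \<open>\<open>v_lim\<close> serves twice: first for the limit whose ceiling is the number of
  copies, then for the limit on the number of queries. The ratio \<open>(K * n) powr c\<close> is
  computed through \<open>Exp\<close> and \<open>Ln\<close>.\<close>

definition setup_phase :: "real \<Rightarrow> real \<Rightarrow> com" where
  "setup_phase c B = Seq (Assign v_rho (Fst (Var 0))) (Seq (Assign v_model (Snd (Var 0)))
     (Seq count_vertices (Seq (Assign v_lim (Add (Const 2)
        (Div (Mul (Const (1600 * c\<^sup>2)) (Var v_n)) (Mul (Var v_rho) (Var v_rho)))))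
     (Seq make_counter (Seq copy_all
     (Seq (Assign v_ratio (Exp (Mul (Const c) (Ln (Mul (Var v_K) (Var v_n))))))
     (Seq (Assign v_lim (Div (Mul (Const (200 * B)) (Mul (Var v_n) (Var v_n))) (Var v_rho)))
     (Seq (Assign v_y (Const 0)) (Assign v_i (Const 0))))))))))"

text \<open>The guess is \<open>exp (K * y)\<close> because the copies have partition function
  \<open>Z ^ K\<close> and \<open>y\<close> estimates \<open>ln Z\<close>.\<close>

definition prepare_query :: com where
  "prepare_query = Seq
     (Assign 0 (PairE (Var v_ratio) (PairE (Exp (Mul (Var v_K) (Var v_y))) (Var v_out)))) (clear (m - 1))"

text \<open>An answer other than \<open>Nul\<close> claims a large partition function and hence
  raises the estimate.\<close>

definition update_estimate :: com where
  "update_estimate = Seq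
     (Cond (Var 0) (Assign v_y (Add (Var v_y) (Div (Var v_rho) (Const 20))))
       (Assign v_y (Sub (Var v_y) (Div (Var v_rho) (Const 20)))))
     (Assign v_i (Add (Var v_i) (Const 1)))"

definition search_phase :: "com \<Rightarrow> com" where
  "search_phase p = While (Less (Var v_i) (Var v_lim)) (Seq prepare_query (Seq p update_estimate))"

definition approximator :: "real \<Rightarrow> real \<Rightarrow> com \<Rightarrow> com" where
  "approximator c B p = Seq (setup_phase c B) (Seq (search_phase p) (Assign 0 (Exp (Var v_y))))"

section \<open>Effect of the phases of the approximator\<close>

definition setup_time :: "nat \<Rightarrow> nat \<Rightarrow> nat" where
  "setup_time n K = K * (n * (K * (n * 7 + 7) + 11) + 7) + n * 5 + K * 5 + 31"

lemma det_setup_phase: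
  assumes s: "s 0 = Pair (Atom \<rho>) (encode M)" and M: "simple_graph n (edges M)" "order M = n"
    and n: "n \<ge> 1" and K: "K = nat \<lceil>2 + 1600 * c\<^sup>2 * real n / (\<rho> * \<rho>)\<rceil>" "K \<ge> 1"
  shows "\<exists>s'. det (setup_phase c B) s (setup_time n K) s' \<and> s' v_rho = Atom \<rho> \<and> s' v_K = Atom (real K)
    \<and> s' v_out = encode (copies K M) \<and> s' v_ratio = Atom (real (K * n) powr c)
    \<and> s' v_lim = Atom (200 * B * (real n * real n) / \<rho>) \<and> s' v_y = Atom 0 \<and> s' v_i = Atom 0"
proof -
  let ?fl = "\<lambda>v. encode_list (map (\<lambda>i. Atom (field M v i)) [1..<spins M + 1])"
  let ?es = "\<lambda>v. map (\<lambda>u. if {u, v} \<in> edges M then Atom (beta M {u, v}) else Nul) [0..<n]"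
  let ?vs = "map (\<lambda>v. Pair (?fl v) (encode_list (?es v))) [0..<n]"
  have enc: "encode M = encode_list ?vs"
    unfolding encode_def encode_vertex_def M(2) ..
  define s1 where "s1 = s(v_rho := Atom \<rho>)"
  define s2 where "s2 = s1(v_model := encode_list ?vs)"
  have d1: "det (Assign v_rho (Fst (Var 0))) s 1 s1"
    using det_Assign[of v_rho "Fst (Var 0)" s] s by (simp add: s1_def)
  have d2: "det (Assign v_model (Snd (Var 0))) s1 1 s2"
    using det_Assign[of v_model "Snd (Var 0)" s1] s unfolding enc by (simp add: s1_def s2_def)
  have "s2 v_model = encode_list ?vs" by (simp add: s2_def)
  from det_count_vertices[of s2, OF this] obtain s3 where
    d3: "det count_vertices s2 (n * 5 + 5) s3" and f3: "frame {v_a, v_n} s2 s3" and n3: "s3 v_n = Atom (real n)"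
    by auto
  let ?l = "2 + 1600 * c\<^sup>2 * real n / (\<rho> * \<rho>)"
  define s4 where "s4 = s3(v_lim := Atom ?l)"
  have r3: "s3 v_rho = Atom \<rho>" "s3 v_model = encode_list ?vs"
    using f3 by (simp_all add: frame_def s2_def s1_def)
  have d4: "det (Assign v_lim (Add (Const 2) (Div (Mul (Const (1600 * c\<^sup>2)) (Var v_n)) (Mul (Var v_rho) (Var v_rho))))) s3 1 s4"
    using det_Assign[of v_lim "Add (Const 2) (Div (Mul (Const (1600 * c\<^sup>2)) (Var v_n)) (Mul (Var v_rho) (Var v_rho)))" s3]
    by (simp add: s4_def n3 r3)
  have "s4 v_lim = Atom ?l" by (simp add: s4_def)
  from det_make_counter[of s4, OF this K(1)] obtain s5 where
    d5: "det make_counter s4 (K * 5 + 5) s5" and f5: "frame {v_copies, v_K} s4 s5"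
    and s5: "s5 v_K = Atom (real K)" "s5 v_copies = encode_list (map Atom (map real (rev [0..<K])))"
    by auto
  let ?js = "map real (rev [0..<K])"
  have r5: "s5 v_rho = Atom \<rho>" "s5 v_n = Atom (real n)" "s5 v_model = encode_list ?vs"
    using f5 n3 r3 by (simp_all add: frame_def s4_def)
  \<comment> \<open>The labels come out as \<open>K - 1\<close> down to 0;
    \<open>encode_copies\<close> asks only for their number and distinctness.\<close>
  have js: "length ?js = K" "distinct ?js" by (auto simp: distinct_map)
  obtain s6 where
    d6: "det copy_all s5 (K * (n * (K * (n * 7 + 7) + 11) + 7) + 5) s6"
    and f6: "frame {v_a, v_b, v_c, v_d, v_row, v_out} s5 s6"
    and s6: "s6 v_out = encode_list (rev (concat (map (\<lambda>j. map (\<lambda>v. Pair (?fl v) (copied_row ?js j (?es v))) [0..<n]) ?js)))"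
    using det_copy_all[of s5 ?fl ?es "[0..<n]" ?js n, OF r5(3) s5(2)] unfolding js(1) by auto
  have out: "s6 v_out = encode (copies K M)"
    unfolding s6 encode_copies[OF M js] by (simp add: copied_row_def encode_vertex_def)
  have r6: "s6 v_rho = Atom \<rho>" "s6 v_n = Atom (real n)" "s6 v_K = Atom (real K)"
    using f6 r5 s5 by (simp_all add: frame_def)
  \<comment> \<open>Positivity of \<open>K * n\<close> matters: at 0 the default value of
    \<open>Ln\<close> would give 1, whereas \<open>powr\<close> gives 0.\<close>
  have ratio: "evaluate (Exp (Mul (Const c) (Ln (Mul (Var v_K) (Var v_n))))) s6 = Atom (real (K * n) powr c)"
    using n K(2) by (simp add: r6 powr_def)
  define s7 where "s7 = s6(v_ratio := Atom (real (K * n) powr c))"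
  have d7: "det (Assign v_ratio (Exp (Mul (Const c) (Ln (Mul (Var v_K) (Var v_n)))))) s6 1 s7"
    unfolding s7_def ratio[symmetric] by (rule det_Assign)
  define s8 where "s8 = s7(v_lim := Atom (200 * B * (real n * real n) / \<rho>))"
  have d8: "det (Assign v_lim (Div (Mul (Const (200 * B)) (Mul (Var v_n) (Var v_n))) (Var v_rho))) s7 1 s8"
    using det_Assign[of v_lim "Div (Mul (Const (200 * B)) (Mul (Var v_n) (Var v_n))) (Var v_rho)" s7]
    by (simp add: s8_def s7_def r6)
  have d9: "det (Assign v_y (Const 0)) s8 1 (s8(v_y := Atom 0))"
    using det_Assign[of v_y "Const 0" s8] by simp
  have d10: "det (Assign v_i (Const 0)) (s8(v_y := Atom 0)) 1 (s8(v_y := Atom 0, v_i := Atom 0))"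
    using det_Assign[of v_i "Const 0" "s8(v_y := Atom 0)"] by simp
  have "det (setup_phase c B) s (setup_time n K) (s8(v_y := Atom 0, v_i := Atom 0))"
    unfolding setup_phase_def
    by (rule det_mono[OF det_Seq[OF d1 det_Seq[OF d2 det_Seq[OF d3 det_Seq[OF d4 det_Seq[OF d5
      det_Seq[OF d6 det_Seq[OF d7 det_Seq[OF d8 det_Seq[OF d9 d10]]]]]]]]]]) (simp add: setup_time_def)
  then show ?thesis
    using out r6 by (intro exI[of _ "s8(v_y := Atom 0, v_i := Atom 0)"]) (simp add: s8_def s7_def)
qed

text \<open>After clearing, the part of the store below \<open>m\<close> is exactly the initial
  store of \<open>run\<close> on the query, as \<open>wp_overlay\<close> and
  \<open>wp_output\<close> require.\<close>

lemma det_prepare_query: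
  assumes m: "m \<ge> 1"
  shows "det prepare_query s (2 * m) (overlay m ((\<lambda>x. Nul)(0 :=
    Pair (s v_ratio) (Pair (Atom (exp (num (s v_K) * num (s v_y)))) (s v_out)))) s)"
proof -
  let ?inp = "Pair (s v_ratio) (Pair (Atom (exp (num (s v_K) * num (s v_y)))) (s v_out))"
  let ?a = "Assign 0 (PairE (Var v_ratio) (PairE (Exp (Mul (Var v_K) (Var v_y))) (Var v_out)))"
  have "det ?a s 1 (s(0 := ?inp))"
    using det_Assign[of 0 "PairE (Var v_ratio) (PairE (Exp (Mul (Var v_K) (Var v_y))) (Var v_out))" s] by simp
  from det_Seq[OF this det_clear[of "m - 1"]]
  have "det prepare_query s (2 * m) (\<lambda>x. if 1 \<le> x \<and> x \<le> m - 1 then Nul else (s(0 := ?inp)) x)"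
    unfolding prepare_query_def by (rule det_mono) (use m in simp)
  moreover have "(\<lambda>x. if 1 \<le> x \<and> x \<le> m - 1 then Nul else (s(0 := ?inp)) x) = overlay m ((\<lambda>x. Nul)(0 := ?inp)) s"
    using m by (auto simp: overlay_def fun_eq_iff)
  ultimately show ?thesis by simp
qed

lemma det_update_estimate:
  "det update_estimate s 4 (s(v_y := Atom (if s 0 \<noteq> Nul then num (s v_y) + num (s v_rho) / 20
     else num (s v_y) - num (s v_rho) / 20), v_i := Atom (num (s v_i) + 1)))"
proof -
  let ?s = "s(v_y := Atom (if s 0 \<noteq> Nul then num (s v_y) + num (s v_rho) / 20 else num (s v_y) - num (s v_rho) / 20))"
  have "det (Cond (Var 0) (Assign v_y (Add (Var v_y) (Div (Var v_rho) (Const 20))))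
       (Assign v_y (Sub (Var v_y) (Div (Var v_rho) (Const 20))))) s (Suc 1) ?s"
    using det_Assign[of v_y "Add (Var v_y) (Div (Var v_rho) (Const 20))" s]
      det_Assign[of v_y "Sub (Var v_y) (Div (Var v_rho) (Const 20))" s]
    by (intro det_Cond) auto
  from det_Seq[OF this det_Assign[of v_i "Add (Var v_i) (Const 1)"]]
  have "det update_estimate s 4 (?s(v_i := evaluate (Add (Var v_i) (Const 1)) ?s))"
    unfolding update_estimate_def by (rule det_mono) simp
  then show ?thesis by simp
qed

text \<open>The random walk as a program: \<open>query\<close> is the guarantee of the subroutine in
  units of one search step, silent at distance below 1 from \<open>lz\<close>. The drift bound of
  \<open>potential_step\<close> is iterated through \<open>wp_while_le\<close>.\<close>

lemma wp_search_phase: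
  fixes \<rho> lz :: real
  assumes m: "m \<ge> 1" and p: "cvars p \<subseteq> {..<m}" and \<rho>: "\<rho> > 0" and \<kappa>: "\<kappa> \<ge> 0"
    and s: "s v_rho = Atom \<rho>" "s v_K = Atom K" "s v_out = enc" "s v_ratio = r" "s v_lim = Atom l" "s v_i = Atom 0"
    and N: "N = nat \<lceil>l\<rceil>"
    and query: "\<And>y. \<exists>t\<le>T. let inp = Pair r (Pair (Atom (exp (K * y))) enc) in halts_within p inp t
      \<and> ((y - lz) / (\<rho> / 20) \<ge> 1 \<longrightarrow> measure_pmf.prob (output_dist p inp t) {Nul} \<ge> 5/8)
      \<and> ((y - lz) / (\<rho> / 20) \<le> -1 \<longrightarrow> measure_pmf.prob (output_dist p inp t) (- {Nul}) \<ge> 5/8)"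
    and f: "\<And>s. f s \<le> ennreal (\<kappa> * potential ((num (s v_y) - lz) / (\<rho> / 20)))"
  shows "wp (N * (2 * m + T + 8) + 1) (search_phase p) f s
    \<le> ennreal (\<kappa> * ((31/32) ^ N * potential ((num (s v_y) - lz) / (\<rho> / 20)) + 32))"
proof -
  let ?D = "\<lambda>y. (y - lz) / (\<rho> / 20)"
  define V where "V = {..<m} \<union> {v_y, v_i}"
  \<comment> \<open>This is \<open>\<kappa>\<close> times the \<open>k\<close>-fold iterate of
    \<open>31/32 * P + 1\<close>, whose fixed point is 32.\<close>
  define E where "E = (\<lambda>k P. \<kappa> * ((31/32) ^ k * P + 32 * (1 - (31/32) ^ k)) :: real)"
  \<comment> \<open>With \<open>k\<close> queries to go the counter shows \<open>N - k\<close>; the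
    condition \<open>k \<le> N\<close> prevents truncation of the subtraction.\<close>
  define ok where "ok = (\<lambda>k s'. frame V s s' \<and> k \<le> N \<and> s' v_i = Atom (real (N - k)))"
  define J where "J = (\<lambda>k s'. if ok k s' then ennreal (E k (potential (?D (num (s' v_y))))) else \<top>)"
  have time: "2 * m + T + 6 + 2 = 2 * m + T + 8" by simp
  have E_nonneg: "E k P \<ge> 0" if "P \<ge> 0" for k P
    using \<kappa> that by (simp add: E_def power_le_one)
  have ok_sel: "s' v_rho = Atom \<rho>" "s' v_K = Atom K" "s' v_out = enc" "s' v_ratio = r" "s' v_lim = Atom l"
    if "ok k s'" for k s'
    using that s unfolding ok_def V_def frame_def by auto
  have "wp (N * ((2 * m + T + 6) + 2) + 1) (search_phase p) f s \<le> J N s"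
    unfolding search_phase_def
  proof (rule wp_while_le)
    fix k s1 assume "J (Suc k) s1 < \<top>"
    then have ok: "ok (Suc k) s1" by (auto simp: J_def split: if_splits)
    define y where "y = num (s1 v_y)"
    have "N - Suc k < N" using ok by (auto simp: ok_def)
    then have "real (N - Suc k) < l" unfolding N less_nat_ceiling_iff .
    then have guard: "evaluate (Less (Var v_i) (Var v_lim)) s1 \<noteq> Nul"
      using ok ok_sel(5)[OF ok] by (auto simp: truth_def ok_def)
    let ?inp = "Pair r (Pair (Atom (exp (K * y))) enc)"
    let ?s0 = "(\<lambda>x. Nul)(0 := ?inp)"
    obtain t where t: "t \<le> T" "halts_within p ?inp t"
      "?D y \<ge> 1 \<Longrightarrow> measure_pmf.prob (output_dist p ?inp t) {Nul} \<ge> 5/8"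
      "?D y \<le> -1 \<Longrightarrow> measure_pmf.prob (output_dist p ?inp t) (- {Nul}) \<ge> 5/8"
      using query[of y] unfolding Let_def by blast
    have prep: "det prepare_query s1 (2 * m) (overlay m ?s0 s1)"
      using det_prepare_query[OF m, of s1] ok_sel[OF ok] by (simp add: y_def)
    let ?a = "E k (potential (?D y + 1))" and ?b = "E k (potential (?D y - 1))"
    \<comment> \<open>Of all that the subroutine leaves below \<open>m\<close>, only whether
      variable 0 is \<open>Nul\<close> influences the update.\<close>
    have upd: "wp 4 update_estimate (J k) (overlay m s'' s1)
        \<le> (if s'' 0 \<in> - {Nul} then ennreal ?a else ennreal ?b)" for s''
    proof -
      let ?o = "overlay m s'' s1"
      let ?o' = "?o(v_y := Atom (if ?o 0 \<noteq> Nul then num (?o v_y) + num (?o v_rho) / 20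
         else num (?o v_y) - num (?o v_rho) / 20), v_i := Atom (num (?o v_i) + 1))"
      have o: "?o 0 = s'' 0" "?o v_y = s1 v_y" "?o v_rho = Atom \<rho>" "?o v_i = Atom (real (N - Suc k))"
        using m ok ok_sel[OF ok] by (auto simp: overlay_def ok_def)
      have "ok k ?o'"
        using ok o unfolding ok_def V_def frame_def by (auto simp: overlay_def)
      moreover have "?D (y + \<rho> / 20) = ?D y + 1" "?D (y - \<rho> / 20) = ?D y - 1"
        using \<rho> by (simp_all add: field_simps)
      ultimately have eq: "J k ?o' = (if s'' 0 \<in> - {Nul} then ennreal ?a else ennreal ?b)"
        using o by (simp add: J_def y_def)
      have "wp 4 update_estimate (J k) ?o \<le> J k ?o'"
        by (rule det_update_estimate[unfolded det_def, rule_format])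
      then show ?thesis unfolding eq .
    qed
    let ?u = "measure_pmf.prob (output_dist p ?inp t) (- {Nul})"
    have u: "?u = 1 - measure_pmf.prob (output_dist p ?inp t) {Nul}"
      using measure_pmf.prob_compl[of "{Nul}" "output_dist p ?inp t"] by (simp add: Compl_eq_Diff_UNIV)
    have "wp (2 * m + T + 6) (Seq prepare_query (Seq p update_estimate)) (J k) s1
        \<le> wp (2 * m + (t + 4 + 1) + 1) (Seq prepare_query (Seq p update_estimate)) (J k) s1"
      using t(1) by (intro wp_antimono) simp
    also have "\<dots> \<le> wp (2 * m) prepare_query (wp (t + 4 + 1) (Seq p update_estimate) (J k)) s1"
      by (rule wp_Seq)
    also have "\<dots> \<le> wp (t + 4 + 1) (Seq p update_estimate) (J k) (overlay m ?s0 s1)"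
      using prep unfolding det_def by blast
    also have "\<dots> \<le> wp t p (wp 4 update_estimate (J k)) (overlay m ?s0 s1)"
      by (rule wp_Seq)
    also have "\<dots> = wp t p (\<lambda>s''. wp 4 update_estimate (J k) (overlay m s'' s1)) ?s0"
      by (rule wp_overlay[OF p])
    also have "\<dots> \<le> wp t p (\<lambda>s''. (\<lambda>v. if v \<in> - {Nul} then ennreal ?a else ennreal ?b) (s'' 0)) ?s0"
      using upd by (intro wp_mono) simp
    also have "\<dots> = (\<integral>\<^sup>+ v. (if v \<in> - {Nul} then ennreal ?a else ennreal ?b) \<partial>output_dist p ?inp t)"
      by (rule wp_output[OF t(2)])
    also have "\<dots> = ennreal (?u * ?a + (1 - ?u) * ?b)"
      by (rule nn_integral_two_valued) (auto intro!: E_nonneg potential_nonneg)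
    also have "\<dots> \<le> ennreal (E (Suc k) (potential (?D y)))"
    proof (rule ennreal_leI)
      \<comment> \<open>\<open>E k\<close> is affine and nondecreasing in its last argument, so
        averaging over the answer reduces to one step of the walk with upward probability
        \<open>?u\<close>.\<close>
      have "?u * potential (?D y + 1) + (1 - ?u) * potential (?D y - 1) \<le> 31/32 * potential (?D y) + 1"
        using t(3,4) u by (intro potential_step) auto
      then have "\<kappa> * (31/32) ^ k * (?u * potential (?D y + 1) + (1 - ?u) * potential (?D y - 1))
          \<le> \<kappa> * (31/32) ^ k * (31/32 * potential (?D y) + 1)"
        using \<kappa> by (intro mult_left_mono) auto
      then show "?u * ?a + (1 - ?u) * ?b \<le> E (Suc k) (potential (?D y))"
        by (simp add: E_def algebra_simps)
    qed
    also have "\<dots> = J (Suc k) s1"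
      using ok by (simp add: J_def y_def)
    finally show "evaluate (Less (Var v_i) (Var v_lim)) s1 \<noteq> Nul \<and>
        wp (2 * m + T + 6) (Seq prepare_query (Seq p update_estimate)) (J k) s1 \<le> J (Suc k) s1"
      using guard by simp
  next
    fix s1 assume "J 0 s1 < \<top>"
    then have ok: "ok 0 s1" by (auto simp: J_def split: if_splits)
    have "\<not> real N < l" using less_nat_ceiling_iff[of N l] N by simp
    then show "evaluate (Less (Var v_i) (Var v_lim)) s1 = Nul \<and> f s1 \<le> J 0 s1"
      using ok ok_sel(5)[OF ok] f[of s1] by (auto simp: truth_def ok_def J_def E_def)
  qed
  also have "J N s = ennreal (E N (potential (?D (num (s v_y)))))"
    using s by (simp add: J_def ok_def)
  also have "\<dots> \<le> ennreal (\<kappa> * ((31/32) ^ N * potential (?D (num (s v_y))) + 32))"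
    unfolding E_def using \<kappa> by (intro ennreal_leI mult_left_mono) auto
  finally show ?thesis unfolding time .
qed

end

section \<open>Running time and error\<close>

text \<open>The bound has the form used in \<open>fpras\<close>; the absolute value gives closure
  under products regardless of signs.\<close>

definition poly_bounded :: "(nat \<Rightarrow> real \<Rightarrow> real) \<Rightarrow> bool" where
  "poly_bounded f \<longleftrightarrow> (\<exists>C k. \<forall>n\<ge>1. \<forall>\<rho>>0. \<bar>f n \<rho>\<bar> \<le> C * (real n + 1 / \<rho>) ^ k)"

lemma poly_bounded_mono:
  assumes "poly_bounded g" and "\<And>n \<rho>. n \<ge> 1 \<Longrightarrow> \<rho> > 0 \<Longrightarrow> \<bar>f n \<rho>\<bar> \<le> \<bar>g n \<rho>\<bar>"
  shows "poly_bounded f"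
  using assms unfolding poly_bounded_def by (meson order_trans)

lemma poly_bounded_const: "poly_bounded (\<lambda>n \<rho>. a)"
  unfolding poly_bounded_def by (rule exI[of _ "\<bar>a\<bar>"], rule exI[of _ 0]) simp

lemma poly_bounded_size: "poly_bounded (\<lambda>n \<rho>. real n)"
  unfolding poly_bounded_def by (rule exI[of _ 1], rule exI[of _ 1]) simp

lemma poly_bounded_inverse_precision: "poly_bounded (\<lambda>n \<rho>. 1 / \<rho>)"
  unfolding poly_bounded_def by (rule exI[of _ 1], rule exI[of _ 1]) simp

lemma
  assumes "poly_bounded f" "poly_bounded g"
  shows poly_bounded_add: "poly_bounded (\<lambda>n \<rho>. f n \<rho> + g n \<rho>)"
    and poly_bounded_mult: "poly_bounded (\<lambda>n \<rho>. f n \<rho> * g n \<rho>)"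
proof -
  obtain C k where f: "\<And>n \<rho>. n \<ge> 1 \<Longrightarrow> \<rho> > 0 \<Longrightarrow> \<bar>f n \<rho>\<bar> \<le> C * (real n + 1 / \<rho>) ^ k"
    using assms(1) unfolding poly_bounded_def by blast
  obtain C' k' where g: "\<And>n \<rho>. n \<ge> 1 \<Longrightarrow> \<rho> > 0 \<Longrightarrow> \<bar>g n \<rho>\<bar> \<le> C' * (real n + 1 / \<rho>) ^ k'"
    using assms(2) unfolding poly_bounded_def by blast
  have "\<bar>f n \<rho> + g n \<rho>\<bar> \<le> (\<bar>C\<bar> + \<bar>C'\<bar>) * (real n + 1 / \<rho>) ^ (k + k')
      \<and> \<bar>f n \<rho> * g n \<rho>\<bar> \<le> (\<bar>C\<bar> * \<bar>C'\<bar>) * (real n + 1 / \<rho>) ^ (k + k')" if n: "n \<ge> 1" "\<rho> > 0" for n \<rho>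
  proof
    define X where "X = real n + 1 / \<rho>"
    \<comment> \<open>Since the base is at least 1, both bounds can be raised to the common exponent
      \<open>k + k'\<close>.\<close>
    have X: "X \<ge> 1" using n unfolding X_def by (simp add: add_increasing2)
    have 1: "\<bar>f n \<rho>\<bar> \<le> \<bar>C\<bar> * X ^ k"
      using f[OF n] X by (fold X_def) (meson abs_ge_self mult_right_mono order_trans zero_le_power zero_le_one)
    have 2: "\<bar>g n \<rho>\<bar> \<le> \<bar>C'\<bar> * X ^ k'"
      using g[OF n] X by (fold X_def) (meson abs_ge_self mult_right_mono order_trans zero_le_power zero_le_one)
    have "\<bar>C\<bar> * X ^ k \<le> \<bar>C\<bar> * X ^ (k + k')" "\<bar>C'\<bar> * X ^ k' \<le> \<bar>C'\<bar> * X ^ (k + k')"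
      using X by (auto intro!: mult_left_mono power_increasing)
    then show "\<bar>f n \<rho> + g n \<rho>\<bar> \<le> (\<bar>C\<bar> + \<bar>C'\<bar>) * (real n + 1 / \<rho>) ^ (k + k')"
      unfolding X_def[symmetric] distrib_right using 1 2 by linarith
    have "\<bar>f n \<rho>\<bar> * \<bar>g n \<rho>\<bar> \<le> (\<bar>C\<bar> * X ^ k) * (\<bar>C'\<bar> * X ^ k')"
      using 1 2 X by (intro mult_mono) auto
    then show "\<bar>f n \<rho> * g n \<rho>\<bar> \<le> (\<bar>C\<bar> * \<bar>C'\<bar>) * (real n + 1 / \<rho>) ^ (k + k')"
      unfolding X_def[symmetric] by (simp add: abs_mult power_add mult_ac)
  qed
  then show "poly_bounded (\<lambda>n \<rho>. f n \<rho> + g n \<rho>)" "poly_bounded (\<lambda>n \<rho>. f n \<rho> * g n \<rho>)"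
    unfolding poly_bounded_def by blast+
qed

lemma poly_bounded_power: "poly_bounded f \<Longrightarrow> poly_bounded (\<lambda>n \<rho>. f n \<rho> ^ k)"
  by (induction k) (auto intro: poly_bounded_mult poly_bounded_const[of 1, simplified])

lemmas poly_bounded_intros = poly_bounded_const poly_bounded_size poly_bounded_inverse_precision
  poly_bounded_add poly_bounded_mult poly_bounded_power

lemma poly_bounded_nat_ceiling:
  assumes "poly_bounded f" "\<And>n \<rho>. n \<ge> 1 \<Longrightarrow> \<rho> > 0 \<Longrightarrow> f n \<rho> \<ge> 0"
  shows "poly_bounded (\<lambda>n \<rho>. real (nat \<lceil>f n \<rho>\<rceil>))"
proof (rule poly_bounded_mono)
  show "poly_bounded (\<lambda>n \<rho>. f n \<rho> + 1)" using assms(1) by (intro poly_bounded_intros)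
  fix n \<rho> assume "n \<ge> (1::nat)" "\<rho> > (0::real)"
  from assms(2)[OF this] show "\<bar>real (nat \<lceil>f n \<rho>\<rceil>)\<bar> \<le> \<bar>f n \<rho> + 1\<bar>" by linarith
qed

lemma poly_bounded_nat_floor:
  assumes "poly_bounded f"
  shows "poly_bounded (\<lambda>n \<rho>. real (nat \<lfloor>f n \<rho>\<rfloor>))"
proof (rule poly_bounded_mono[OF assms])
  fix n \<rho>
  show "\<bar>real (nat \<lfloor>f n \<rho>\<rfloor>)\<bar> \<le> \<bar>f n \<rho>\<bar>" by linarith
qed

section \<open>Parameters and total running time of the approximator\<close>

definition copy_count :: "real \<Rightarrow> nat \<Rightarrow> real \<Rightarrow> nat" where
  "copy_count c n \<rho> = nat \<lceil>2 + 1600 * c\<^sup>2 * real n / (\<rho> * \<rho>)\<rceil>"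

definition query_count :: "real \<Rightarrow> nat \<Rightarrow> real \<Rightarrow> nat" where
  "query_count B n \<rho> = nat \<lceil>200 * B * (real n * real n) / \<rho>\<rceil>"

text \<open>The subroutine is queried on \<open>K * n\<close> vertices, so its own bound is
  evaluated there; it stays polynomial because \<open>copy_count\<close> is polynomially
  bounded.\<close>

definition approximator_time :: "nat \<Rightarrow> real \<Rightarrow> real \<Rightarrow> real \<Rightarrow> nat \<Rightarrow> nat \<Rightarrow> real \<Rightarrow> nat" where
  "approximator_time m c B C k n \<rho> = setup_time n (copy_count c n \<rho>)
     + (query_count B n \<rho> * (2 * m + nat \<lfloor>C * real (copy_count c n \<rho> * n) ^ k\<rfloor> + 8) + 1 + 1 + 1) + 1"

lemma poly_bounded_approximator_time:
  assumes "B \<ge> 0"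
  shows "poly_bounded (\<lambda>n \<rho>. real (approximator_time m c B C k n \<rho>))"
proof -
  have "poly_bounded (\<lambda>n \<rho>. 2 + 1600 * c\<^sup>2 * real n * ((1 / \<rho>) * (1 / \<rho>)))"
    by (intro poly_bounded_intros)
  then have K: "poly_bounded (\<lambda>n \<rho>. real (copy_count c n \<rho>))"
    unfolding copy_count_def by (intro poly_bounded_nat_ceiling) simp_all
  have "poly_bounded (\<lambda>n \<rho>. 200 * B * (real n * real n) * (1 / \<rho>))"
    by (intro poly_bounded_intros)
  then have N: "poly_bounded (\<lambda>n \<rho>. real (query_count B n \<rho>))"
    unfolding query_count_def using assms by (intro poly_bounded_nat_ceiling) simp_all
  have T: "poly_bounded (\<lambda>n \<rho>. real (nat \<lfloor>C * (real (copy_count c n \<rho>) * real n) ^ k\<rfloor>))"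
    by (intro poly_bounded_nat_floor poly_bounded_intros K)
  show ?thesis
    unfolding approximator_time_def setup_time_def of_nat_add of_nat_mult
    by (intro poly_bounded_intros K N T)
qed

text \<open>The number of copies is chosen so that the \<open>K\<close>-th root of the ratio \<open>(K n)\<^sup>c\<close> is at most one step
  \<open>exp (\<rho>/20)\<close> of the search.\<close>

lemma copy_count_bounds:
  assumes n: "n \<ge> 1" and \<rho>: "\<rho> > 0" and c: "c > 0"
  defines "K \<equiv> copy_count c n \<rho>"
  shows "K \<ge> 2" and "c * ln (real (K * n)) \<le> real K * \<rho> / 20"
proof -
  have l: "2 + 1600 * c\<^sup>2 * real n / (\<rho> * \<rho>) \<le> real K"
    unfolding K_def copy_count_def by linarith
  have nn: "0 \<le> 1600 * c\<^sup>2 * real n / (\<rho> * \<rho>)" by simp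
  \<comment> \<open>The summand 2 in \<open>copy_count\<close> ensures \<open>K * n > 1\<close> even
    for \<open>n = 1\<close>, so that the ratio exceeds 1 and the decision guarantee
    applies.\<close>
  have "2 \<le> real K" using l nn by linarith
  then show K2: "K \<ge> 2" by simp
  have Kl: "1600 * c\<^sup>2 * real n / (\<rho> * \<rho>) \<le> real K" using l by linarith
  then have "1600 * c\<^sup>2 * real n \<le> real K * (\<rho> * \<rho>)"
    using \<rho> by (simp add: divide_le_eq)
  then have "real K * (1600 * c\<^sup>2 * real n) \<le> real K * (real K * (\<rho> * \<rho>))"
    by (rule mult_left_mono) simp
  moreover have "(40 * c * sqrt (real (K * n)))\<^sup>2 = real K * (1600 * c\<^sup>2 * real n)"
    by (simp add: power_mult_distrib)
  moreover have "(real K * \<rho>)\<^sup>2 = real K * (real K * (\<rho> * \<rho>))"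
    by (simp add: power2_eq_square mult_ac)
  ultimately have "(40 * c * sqrt (real (K * n)))\<^sup>2 \<le> (real K * \<rho>)\<^sup>2"
    by (simp only:)
  then have sq: "40 * c * sqrt (real (K * n)) \<le> real K * \<rho>"
    by (rule power2_le_imp_le) (use \<rho> in simp)
  have pos: "real (K * n) > 0" using K2 n by simp
  \<comment> \<open>Passing to the square root gives \<open>ln x \<le> 2 * sqrt x\<close>. It then
    suffices that \<open>40 * c * sqrt (K * n) \<le> K * \<rho>\<close>, whose square explains the
    constant 1600.\<close>
  then have "ln (real (K * n)) = 2 * ln (sqrt (real (K * n)))"
    by (simp add: ln_sqrt)
  also have "\<dots> \<le> 2 * sqrt (real (K * n))"
    using ln_le_minus_one[of "sqrt (real (K * n))"] pos by simp
  finally have "c * ln (real (K * n)) \<le> c * (2 * sqrt (real (K * n)))"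
    using c by (intro mult_left_mono) auto
  then show "c * ln (real (K * n)) \<le> real K * \<rho> / 20" using sq by linarith
qed

text \<open>A wrong output means that \<open>y\<close> is at least \<open>\<rho>\<close>, that is 20
  search steps, away from \<open>ln Z\<close>, where the potential is at least
  \<open>(4/3) ^ 20\<close>. Markov's inequality is applied pointwise, by dominating the failure
  indicator by a multiple of the potential.\<close>

lemma approximator_error:
  assumes M: "M \<in> uniform_models q d b h n" and q: "q \<ge> 1" and h: "h \<ge> 0" and n: "n \<ge> 1"
    and \<rho>: "\<rho> > 0" and c: "c > 0" and m: "m \<ge> 1" and p: "cvars p \<subseteq> {..<m}"
    and query: "\<And>n M guess. n \<ge> 1 \<Longrightarrow> real n powr c > 1 \<Longrightarrow> M \<in> uniform_models q d b h n \<Longrightarrow> \<exists>t.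
        let inp = Pair (Atom (real n powr c)) (Pair (Atom guess) (encode M)); Z = partition_function M in
        real t \<le> C * real n ^ k \<and> halts_within p inp t
        \<and> (Z \<le> guess / real n powr c \<longrightarrow> measure_pmf.prob (output_dist p inp t) {Nul} \<ge> 5/8)
        \<and> (Z \<ge> real n powr c * guess \<longrightarrow> measure_pmf.prob (output_dist p inp t) (- {Nul}) \<ge> 5/8)"
  defines "B \<equiv> ln q + \<bar>b\<bar> + h" and "Z \<equiv> partition_function M"
  shows "wp (approximator_time m c B C k n \<rho>) (approximator m c B p)
      (\<lambda>s. indicator (- {Atom z | z. exp (- \<rho>) * Z \<le> z \<and> z \<le> exp \<rho> * Z}) (s 0))
      ((\<lambda>x. Nul)(0 := Pair (Atom \<rho>) (encode M))) \<le> ennreal (1/4)"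
proof -
  define K N where "K = copy_count c n \<rho>" and "N = query_count B n \<rho>"
  let ?T = "nat \<lfloor>C * real (K * n) ^ k\<rfloor>" and ?r = "real (K * n) powr c"
  let ?s0 = "(\<lambda>x. Nul)(0 := Pair (Atom \<rho>) (encode M)) :: store"
  define G where "G = {Atom z | z. exp (- \<rho>) * Z \<le> z \<and> z \<le> exp \<rho> * Z}"
  define lz where "lz = ln Z"
  note K = copy_count_bounds[OF n \<rho> c, folded K_def]
  have simple: "simple_graph n (edges M)" "order M = n"
    using M by (auto simp: uniform_models_def bounded_models_def)
  have Z: "Z > 0" "\<bar>lz\<bar> \<le> B * real n ^ 2"
    using partition_function_bounds[OF M q n h] by (simp_all add: Z_def lz_def B_def)
  have Zexp: "Z = exp lz" using Z by (simp add: lz_def)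
  have Kn: "K * n \<ge> 1" "K * n > 1" using mult_le_mono[OF K(1) n] by linarith+
  have r: "?r > 1" "?r = exp (c * ln (real (K * n)))"
    using gr_one_powr[OF _ c] Kn by (auto simp: powr_def less_imp_of_nat_less[of 1, simplified] simp del: of_nat_mult)
  have ZK: "partition_function (copies K M) = exp (real K * lz)"
    using partition_function_copies[OF simple, of K] by (simp add: Zexp exp_of_nat_mult flip: Z_def)
  \<comment> \<open>With partition function \<open>Z ^ K\<close> and guess
    \<open>exp (K * y)\<close>, one of the two promises holds once \<open>|y - ln Z|\<close> is at
    least \<open>c * ln (K * n) / K\<close>, hence at a distance of one search step.\<close>
  have query': "\<exists>t\<le>?T. let inp = Pair (Atom ?r) (Pair (Atom (exp (real K * y))) (encode (copies K M))) in
      halts_within p inp t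
      \<and> ((y - lz) / (\<rho> / 20) \<ge> 1 \<longrightarrow> measure_pmf.prob (output_dist p inp t) {Nul} \<ge> 5/8)
      \<and> ((y - lz) / (\<rho> / 20) \<le> -1 \<longrightarrow> measure_pmf.prob (output_dist p inp t) (- {Nul}) \<ge> 5/8)" for y
  proof -
    let ?inp = "Pair (Atom ?r) (Pair (Atom (exp (real K * y))) (encode (copies K M)))"
    obtain t where t: "real t \<le> C * real (K * n) ^ k" "halts_within p ?inp t"
      "exp (real K * lz) \<le> exp (real K * y) / ?r \<Longrightarrow> measure_pmf.prob (output_dist p ?inp t) {Nul} \<ge> 5/8"
      "exp (real K * lz) \<ge> ?r * exp (real K * y) \<Longrightarrow> measure_pmf.prob (output_dist p ?inp t) (- {Nul}) \<ge> 5/8"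
      using query[OF Kn(1) r(1) copies_uniform_models[OF M], of "exp (real K * y)"]
      unfolding Let_def ZK by blast
    have "t \<le> ?T" using t(1) by (simp add: le_nat_floor)
    moreover have "exp (real K * lz) \<le> exp (real K * y) / ?r" if "(y - lz) / (\<rho> / 20) \<ge> 1"
    proof -
      have "\<rho> / 20 \<le> y - lz" using that \<rho> by (simp add: field_simps)
      then have "real K * (\<rho> / 20) \<le> real K * (y - lz)" by (intro mult_left_mono) auto
      then have "real K * lz \<le> real K * y - c * ln (real (K * n))" using K(2) by (simp add: algebra_simps)
      then show ?thesis unfolding r(2) exp_diff[symmetric] by simp
    qed
    moreover have "exp (real K * lz) \<ge> ?r * exp (real K * y)" if "(y - lz) / (\<rho> / 20) \<le> -1"
    proof -
      have "\<rho> / 20 \<le> lz - y" using that \<rho> by (simp add: field_simps)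
      then have "real K * (\<rho> / 20) \<le> real K * (lz - y)" by (intro mult_left_mono) auto
      then have "c * ln (real (K * n)) + real K * y \<le> real K * lz" using K(2) by (simp add: algebra_simps)
      then show ?thesis unfolding r(2) exp_add[symmetric] by simp
    qed
    ultimately show ?thesis using t(2,3,4) unfolding Let_def by blast
  qed
  have K1: "K \<ge> 1" using K(1) by simp
  obtain s1 where s1: "det (setup_phase m c B) ?s0 (setup_time n K) s1"
    "s1 (v_rho m) = Atom \<rho>" "s1 (v_K m) = Atom (real K)" "s1 (v_out m) = encode (copies K M)"
    "s1 (v_ratio m) = Atom ?r" "s1 (v_lim m) = Atom (200 * B * (real n * real n) / \<rho>)"
    "s1 (v_y m) = Atom 0" "s1 (v_i m) = Atom 0"
    using det_setup_phase[of ?s0 \<rho> M n K c m B, OF _ simple n _ K1] unfolding K_def copy_count_def by auto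
  let ?f = "\<lambda>s. indicator (- G) (s 0) :: ennreal"
  let ?g = "wp 1 (Assign 0 (Exp (Var (v_y m)))) ?f"
  have g: "?g s \<le> ennreal ((3/4) ^ 20 * potential ((num (s (v_y m)) - lz) / (\<rho> / 20)))" for s
  proof (cases "Atom (exp (num (s (v_y m)))) \<in> G")
    case True
    then show ?thesis by simp
  next
    case False
    let ?y = "num (s (v_y m))"
    have "\<bar>?y - lz\<bar> \<ge> \<rho>"
    proof (rule ccontr)
      assume "\<not> ?thesis"
      then have "exp (lz - \<rho>) \<le> exp ?y" "exp ?y \<le> exp (lz + \<rho>)" by simp_all
      then have "Atom (exp ?y) \<in> G" unfolding G_def Zexp by (auto simp: exp_diff exp_add exp_minus field_simps)
      with False show False ..
    qed
    then have "20 \<le> \<bar>(?y - lz) / (\<rho> / 20)\<bar>" using \<rho> by (simp add: field_simps)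
    then have "(4/3) powr 20 \<le> (4/3 :: real) powr \<bar>(?y - lz) / (\<rho> / 20)\<bar>" by (intro powr_mono) auto
    also have "\<dots> \<le> potential ((?y - lz) / (\<rho> / 20))" by (rule potential_ge)
    finally have "(3/4) ^ 20 * (4/3) powr 20 \<le> (3/4) ^ 20 * potential ((?y - lz) / (\<rho> / 20))"
      by (intro mult_left_mono) auto
    then have "1 \<le> (3/4) ^ 20 * potential ((?y - lz) / (\<rho> / 20))"
      by (simp add: powr_numeral power_divide)
    then show ?thesis using False by (simp add: ennreal_leI flip: ennreal_1)
  qed
  have "wp (approximator_time m c B C k n \<rho>) (approximator m c B p) ?f ?s0
      \<le> wp (setup_time n K) (setup_phase m c B)
          (wp (N * (2 * m + ?T + 8) + 1 + 1 + 1) (Seq (search_phase m p) (Assign 0 (Exp (Var (v_y m))))) ?f) ?s0"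
    unfolding approximator_def approximator_time_def K_def[symmetric] N_def[symmetric] by (rule wp_Seq)
  also have "\<dots> \<le> wp (N * (2 * m + ?T + 8) + 1 + 1 + 1) (Seq (search_phase m p) (Assign 0 (Exp (Var (v_y m))))) ?f s1"
    using s1(1) unfolding det_def by blast
  also have "\<dots> \<le> wp (N * (2 * m + ?T + 8) + 1) (search_phase m p) ?g s1"
    by (rule wp_Seq)
  also have "\<dots> \<le> ennreal ((3/4) ^ 20 * ((31/32) ^ N * potential ((num (s1 (v_y m)) - lz) / (\<rho> / 20)) + 32))"
  proof (rule wp_search_phase[OF m p \<rho> _ s1(2-6) s1(8)])
    show "N = nat \<lceil>200 * B * (real n * real n) / \<rho>\<rceil>" by (simp add: N_def query_count_def)
  qed (use query' g in auto)
  also have "\<dots> \<le> ennreal (1/4)"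
  proof (rule ennreal_leI)
    \<comment> \<open>The search starts at \<open>y = 0\<close>, so the initial distance is that of
      \<open>ln Z\<close> from 0; the constant 200 is 20 steps per \<open>\<rho>\<close> times the
      10 queries per step of \<open>potential_decay\<close>.\<close>
    have "\<bar>(num (s1 (v_y m)) - lz) / (\<rho> / 20)\<bar> = 20 * \<bar>lz\<bar> / \<rho>"
      using \<rho> by (simp add: s1 abs_mult)
    then have "10 * \<bar>(num (s1 (v_y m)) - lz) / (\<rho> / 20)\<bar> = 200 * \<bar>lz\<bar> / \<rho>" by simp
    also have "\<dots> \<le> 200 * (B * real n ^ 2) / \<rho>"
      using Z(2) \<rho> by (intro divide_right_mono mult_left_mono) auto
    also have "\<dots> \<le> real N"
      unfolding N_def query_count_def power2_eq_square mult.assoc by (rule real_nat_ceiling_ge)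
    finally have "(31/32) ^ N * potential ((num (s1 (v_y m)) - lz) / (\<rho> / 20)) \<le> 2"
      by (rule potential_decay)
    \<comment> \<open>The initial position contributes at most 2 and the fixed point of the drift at
      most 32.\<close>
    then have "(3/4) ^ 20 * ((31/32) ^ N * potential ((num (s1 (v_y m)) - lz) / (\<rho> / 20)) + 32) \<le> (3/4) ^ 20 * (34 :: real)"
      by (intro mult_left_mono) auto
    also have "\<dots> \<le> 1/4" by (simp add: power_divide)
    finally show "(3/4) ^ 20 * ((31/32) ^ N * potential ((num (s1 (v_y m)) - lz) / (\<rho> / 20)) + 32) \<le> (1/4 :: real)" .
  qed
  finally show ?thesis unfolding G_def .
qed

section \<open>From a decision procedure to an approximation scheme\<close>

theorem decision_imp_fpras:
  assumes q: "q \<ge> 1" and h: "h \<ge> 0" and c: "c > 0"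
    and p: "poly_time_decision (uniform_models q d b h) (\<lambda>n. real n powr c) p"
  shows "\<exists>p'. fpras (uniform_models q d b h) p'"
proof -
  obtain C k where query: "\<And>n M guess. n \<ge> 1 \<Longrightarrow> real n powr c > 1 \<Longrightarrow> M \<in> uniform_models q d b h n \<Longrightarrow> \<exists>t.
        let inp = Pair (Atom (real n powr c)) (Pair (Atom guess) (encode M)); Z = partition_function M in
        real t \<le> C * real n ^ k \<and> halts_within p inp t
        \<and> (Z \<le> guess / real n powr c \<longrightarrow> measure_pmf.prob (output_dist p inp t) {Nul} \<ge> 5/8)
        \<and> (Z \<ge> real n powr c * guess \<longrightarrow> measure_pmf.prob (output_dist p inp t) (- {Nul}) \<ge> 5/8)"
    using p unfolding poly_time_decision_def by blast
  \<comment> \<open>Inserting 0 makes the maximum meaningful when no variable occurs, and puts the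
    input and output variable below \<open>m\<close>.\<close>
  define m where "m = Suc (Max (insert 0 (cvars p)))"
  have m: "m \<ge> 1" "cvars p \<subseteq> {..<m}"
    using finite_cvars[of p] by (auto simp: m_def less_Suc_eq_le)
  let ?B = "ln q + \<bar>b\<bar> + h"
  have "?B \<ge> 0" using q h by simp
  from poly_bounded_approximator_time[OF this, of m c C k] obtain C' k' where time:
    "\<And>n \<rho>. n \<ge> 1 \<Longrightarrow> \<rho> > 0 \<Longrightarrow> real (approximator_time m c ?B C k n \<rho>) \<le> C' * (real n + 1 / \<rho>) ^ k'"
    unfolding poly_bounded_def by auto
  have "fpras (uniform_models q d b h) (approximator m c ?B p)"
    unfolding fpras_def
  proof (intro exI allI ballI impI)
    fix n :: nat and M and \<rho> :: real
    assume n: "1 \<le> n" and M: "M \<in> uniform_models q d b h n" and \<rho>: "0 < \<rho>"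
    note err = wp_output_error[OF approximator_error[OF M q h n \<rho> c m query]]
    show "let inp = Pair (Atom \<rho>) (encode M); Z = partition_function M in
        real (approximator_time m c ?B C k n \<rho>) \<le> C' * (real n + 1 / \<rho>) ^ k'
        \<and> halts_within (approximator m c ?B p) inp (approximator_time m c ?B C k n \<rho>)
        \<and> measure_pmf.prob (output_dist (approximator m c ?B p) inp (approximator_time m c ?B C k n \<rho>))
             {Atom z | z. exp (- \<rho>) * Z \<le> z \<and> z \<le> exp \<rho> * Z} \<ge> 3/4"
      using time[OF n \<rho>] err by (simp add: Let_def)
  qed
  then show ?thesis by blast
qed

theorem theorem2p4:
  fixes q d :: nat and \<beta> h :: real and \<M> :: "nat \<Rightarrow> potts set"
  assumes "q \<ge> 2" and "d \<ge> 1" and "\<beta> \<ge> 0" and "h \<ge> 0"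
    and "\<M> \<in> {\<lambda>n. potts_plus q n d \<beta> h, \<lambda>n. ising_minus n d \<beta> h, \<lambda>n. ising_plus n d \<beta> h}"
    and "\<not> (\<exists>p. fpras \<M> p)"
  shows "\<forall>c>0. \<not> (\<exists>p. poly_time_decision \<M> (\<lambda>n. real n powr c) p)"
proof -
  \<comment> \<open>As \<open>\<beta> \<ge> 0\<close>, the sign conditions follow from the common
    edge weight, which is \<open>\<beta>\<close> or \<open>- \<beta>\<close>; the Ising families are
    the case of two spins.\<close>
  have "potts_plus q' n d \<beta> h = uniform_models q' d \<beta> h n" for q' n
    using assms(3) by (auto simp: potts_plus_def uniform_models_def ferromagnetic_def)
  moreover have "ising_minus n d \<beta> h = uniform_models 2 d (- \<beta>) h n" for n
    using assms(3) by (auto simp: ising_minus_def uniform_models_def antiferromagnetic_def)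
  ultimately have "\<exists>q' b. q' \<ge> 1 \<and> \<M> = uniform_models q' d b h"
    using assms(1,5) unfolding ising_plus_def
    by (elim insertE emptyE) (auto intro: exI[of _ q] exI[of _ 2])
  then obtain q' b where \<M>: "q' \<ge> 1" "\<M> = uniform_models q' d b h" by blast
  show ?thesis
    using decision_imp_fpras[OF \<M>(1) assms(4)] assms(6) unfolding \<M>(2) by blast
qed

end
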